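(* Let $\mathcal{S}$ be a strictly convex, $C^3$-smooth surface of revolution and let $p$ be an isolated umbilic point of $\mathcal{S}$ lying on the axis of rotational symmetry. If the umbilic slope $\mu_p$ exists, then $\mu_p\ge 2$. If in addition $\mathcal{S}$ is $C^4$-smooth, then (when $\mu_p$ exists) $\mu_p\ge 3$.
   Context: $\mathcal{S}\subset\mathbb{R}^3$ is a regular oriented surface of revolution about the $z$-axis, fully revolved about it. $k_1$ and $k_2$ denote the principal curvatures along the parallels and along the profile curves respectively, $r_i=1/k_i$ are the radii of curvature, and $K=k_1k_2$ is the Gauss curvature. $\mathcal{S}$ is strictly convex if $K>0$ at every point. The Gauss angle $\theta$ is the angle between the oriented unit normal and the positive $z$-axis; where $K\neq0$ the profile curve $(\rho(\theta),h(\theta))$ in the $yz$-plane ($\rho$ the signed distance from the axis, $h$ the height), with unit normal $(\sin\theta,\cos\theta)$, is locally parametrised by $\theta$, and $r_1,r_2$ are regarded as functions of $\theta$, with $\rho=r_1\sin\theta$, $dh/d\theta=-r_2\sin\theta$. An umbilic point is a point with $r_1=r_2$; it is isolated if some neighbourhood of it in $\mathcal{S}$ contains no other umbilic point. The orientation of the axis is chosen so that $\theta=0$ at $p$. With $r_0$ the common value of $r_1,r_2$ at $p$, the umbilic slope is $\mu_p=\lim_{\theta\to 0}\frac{r_2(\theta)-r_0}{r_1(\theta)-r_0}$, when this limit exists. *)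

theory Defs
  imports "HOL-Analysis.Analysis"
begin

text \<open>Class \<open>C\<^sup>k\<close> on an open set: iterated continuous directional derivatives.\<close>

primrec Ck_on :: "nat \<Rightarrow> ('a::euclidean_space \<Rightarrow> 'b::euclidean_space) \<Rightarrow> 'a set \<Rightarrow> bool" where
  "Ck_on 0 f U \<longleftrightarrow> continuous_on U f"
| "Ck_on (Suc k) f U \<longleftrightarrow>
     f differentiable_on U \<and> (\<forall>v. Ck_on k (\<lambda>x. frechet_derivative f (at x) v) U)"

definition regular_surface :: "nat \<Rightarrow> (real^3) set \<Rightarrow> bool" where
  "regular_surface k S \<longleftrightarrow>
     (\<forall>x\<in>S. \<exists>(U :: (real^2) set) V \<phi> \<psi>.
        open U \<and> open V \<and> x \<in> V \<and> homeomorphism U (S \<inter> V) \<phi> \<psi> \<and>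
        Ck_on k \<phi> U \<and> (\<forall>u\<in>U. inj (frechet_derivative \<phi> (at u))))"

definition tangent_space :: "(real^3) set \<Rightarrow> real^3 \<Rightarrow> (real^3) set" where
  "tangent_space S x =
     {v. \<exists>\<gamma> :: real \<Rightarrow> real^3. \<gamma> 0 = x \<and> (\<forall>\<^sub>F t in nhds 0. \<gamma> t \<in> S) \<and>
           (\<gamma> has_vector_derivative v) (at 0)}"

definition unit_normal_field :: "(real^3) set \<Rightarrow> (real^3 \<Rightarrow> real^3) \<Rightarrow> bool" where
  "unit_normal_field S N \<longleftrightarrow>
     continuous_on S N \<and>
     (\<forall>x\<in>S. norm (N x) = 1 \<and> (\<forall>v\<in>tangent_space S x. N x \<bullet> v = 0))"

definition rot_z :: "real \<Rightarrow> real^3 \<Rightarrow> real^3" where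
  "rot_z \<alpha> x = vector [cos \<alpha> * x$1 - sin \<alpha> * x$2, sin \<alpha> * x$1 + cos \<alpha> * x$2, x$3]"

definition z_axis :: "(real^3) set" where
  "z_axis = {x. x$1 = 0 \<and> x$2 = 0}"

text \<open>An oriented regular surface of class \<open>C\<^sup>k\<close> that is fully revolved about the
  z-axis, with orientation given by the unit normal \<open>N\<close>.\<close>

definition surface_of_revolution :: "nat \<Rightarrow> (real^3) set \<Rightarrow> (real^3 \<Rightarrow> real^3) \<Rightarrow> bool" where
  "surface_of_revolution k S N \<longleftrightarrow>
     regular_surface k S \<and> unit_normal_field S N \<and> (\<forall>\<alpha>. rot_z \<alpha> ` S = S)"

text \<open>The differential of the Gauss map. The Frechet derivative within \<open>S\<close> is determined
  only on tangent vectors of \<open>S\<close>, and is used only there. The sign is such that a round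
  sphere with outward normal has positive principal curvatures; this is what
  \<open>\<rho> = r\<^sub>1 sin \<theta>\<close>, \<open>dh/d\<theta> = - r\<^sub>2 sin \<theta>\<close> with normal \<open>(sin \<theta>, cos \<theta>)\<close> require.\<close>

definition shape_operator :: "(real^3) set \<Rightarrow> (real^3 \<Rightarrow> real^3) \<Rightarrow> real^3 \<Rightarrow> real^3 \<Rightarrow> real^3" where
  "shape_operator S N x = frechet_derivative N (at x within S)"

text \<open>Eigenvalue of the shape operator belonging to the principal direction \<open>v\<close>.\<close>

definition principal_curvature ::
    "(real^3) set \<Rightarrow> (real^3 \<Rightarrow> real^3) \<Rightarrow> real^3 \<Rightarrow> real^3 \<Rightarrow> real" where
  "principal_curvature S N x v = (THE \<kappa>. shape_operator S N x v = \<kappa> *\<^sub>R v)"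

text \<open>On the axis the parallel degenerates; there the direction is the limit of the parallel
  directions along the profile curve in the yz-plane, so that the profile direction is the
  tangent of that profile curve.\<close>

definition parallel_direction :: "real^3 \<Rightarrow> real^3" where
  "parallel_direction x = (if x \<in> z_axis then axis 1 1 else vector [- x$2, x$1, 0])"

definition profile_direction :: "(real^3 \<Rightarrow> real^3) \<Rightarrow> real^3 \<Rightarrow> real^3" where
  "profile_direction N x = cross3 (N x) (parallel_direction x)"

definition k1 :: "(real^3) set \<Rightarrow> (real^3 \<Rightarrow> real^3) \<Rightarrow> real^3 \<Rightarrow> real" where
  "k1 S N x = principal_curvature S N x (parallel_direction x)"

definition k2 :: "(real^3) set \<Rightarrow> (real^3 \<Rightarrow> real^3) \<Rightarrow> real^3 \<Rightarrow> real" where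
  "k2 S N x = principal_curvature S N x (profile_direction N x)"

definition r1 :: "(real^3) set \<Rightarrow> (real^3 \<Rightarrow> real^3) \<Rightarrow> real^3 \<Rightarrow> real" where
  "r1 S N x = 1 / k1 S N x"

definition r2 :: "(real^3) set \<Rightarrow> (real^3 \<Rightarrow> real^3) \<Rightarrow> real^3 \<Rightarrow> real" where
  "r2 S N x = 1 / k2 S N x"

definition gauss_curvature :: "(real^3) set \<Rightarrow> (real^3 \<Rightarrow> real^3) \<Rightarrow> real^3 \<Rightarrow> real" where
  "gauss_curvature S N x = k1 S N x * k2 S N x"

definition strictly_convex :: "(real^3) set \<Rightarrow> (real^3 \<Rightarrow> real^3) \<Rightarrow> bool" where
  "strictly_convex S N \<longleftrightarrow> (\<forall>x\<in>S. gauss_curvature S N x > 0)"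

definition umbilic :: "(real^3) set \<Rightarrow> (real^3 \<Rightarrow> real^3) \<Rightarrow> real^3 \<Rightarrow> bool" where
  "umbilic S N x \<longleftrightarrow> x \<in> S \<and> r1 S N x = r2 S N x"

definition isolated_umbilic :: "(real^3) set \<Rightarrow> (real^3 \<Rightarrow> real^3) \<Rightarrow> real^3 \<Rightarrow> bool" where
  "isolated_umbilic S N p \<longleftrightarrow>
     umbilic S N p \<and> (\<exists>V. open V \<and> p \<in> V \<and> (\<forall>x\<in>S \<inter> V - {p}. \<not> umbilic S N x))"

text \<open>In the following, \<open>a\<close> is the unit vector of the chosen orientation of the z-axis, and
  heights are measured along \<open>a\<close>.\<close>

definition axis_orientation :: "real^3 \<Rightarrow> bool" where
  "axis_orientation a \<longleftrightarrow> a = axis 3 1 \<or> a = - axis 3 1"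

definition gauss_angle :: "real^3 \<Rightarrow> (real^3 \<Rightarrow> real^3) \<Rightarrow> real^3 \<Rightarrow> real" where
  "gauss_angle a N x = arccos (N x \<bullet> a)"

definition profile_point :: "real^3 \<Rightarrow> real \<Rightarrow> real \<Rightarrow> real^3" where
  "profile_point a y z = y *\<^sub>R axis 2 1 + z *\<^sub>R a"

text \<open>\<open>(\<rho>, h)\<close> parametrises, by the signed Gauss angle \<open>\<theta>\<close>, the profile curve in the yz-plane
  through \<open>p\<close>: the unit normal at parameter \<open>\<theta>\<close> is \<open>(sin \<theta>, cos \<theta>)\<close>.\<close>

definition gauss_parametrisation ::
    "(real^3) set \<Rightarrow> (real^3 \<Rightarrow> real^3) \<Rightarrow> real^3 \<Rightarrow> real^3 \<Rightarrow> real \<Rightarrow>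
     (real \<Rightarrow> real) \<Rightarrow> (real \<Rightarrow> real) \<Rightarrow> bool" where
  "gauss_parametrisation S N a p \<epsilon> \<rho> h \<longleftrightarrow>
     \<epsilon> > 0 \<and> continuous_on {-\<epsilon><..<\<epsilon>} \<rho> \<and> continuous_on {-\<epsilon><..<\<epsilon>} h \<and>
     profile_point a (\<rho> 0) (h 0) = p \<and>
     (\<forall>\<theta>\<in>{-\<epsilon><..<\<epsilon>}.
        profile_point a (\<rho> \<theta>) (h \<theta>) \<in> S \<and>
        N (profile_point a (\<rho> \<theta>) (h \<theta>)) = profile_point a (sin \<theta>) (cos \<theta>))"

text \<open>The quotient is a genuine one: near an isolated umbilic point on the axis
  \<open>r\<^sub>1 \<noteq> r\<^sub>0\<close> for \<open>\<theta> \<noteq> 0\<close>, by Rolle's theorem and \<open>sin \<theta> dr\<^sub>1/d\<theta> = (r\<^sub>2 - r\<^sub>1) cos \<theta>\<close>.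
  The germ of \<open>(\<rho>, h)\<close> at \<open>0\<close> is unique where \<open>K \<noteq> 0\<close>.\<close>

definition has_umbilic_slope ::
    "(real^3) set \<Rightarrow> (real^3 \<Rightarrow> real^3) \<Rightarrow> real^3 \<Rightarrow> real^3 \<Rightarrow> real \<Rightarrow> bool" where
  "has_umbilic_slope S N a p \<mu> \<longleftrightarrow>
     (\<exists>\<epsilon> \<rho> h. gauss_parametrisation S N a p \<epsilon> \<rho> h \<and>
        ((\<lambda>\<theta>. (r2 S N (profile_point a (\<rho> \<theta>) (h \<theta>)) - r1 S N p) /
              (r1 S N (profile_point a (\<rho> \<theta>) (h \<theta>)) - r1 S N p)) \<longlongrightarrow> \<mu>) (at 0))"

end

theory Submission
  imports Defs
begin

text \<open>
  Near \<open>p\<close> the surface is a graph over its horizontal tangent plane, with an even profile \<open>g\<close> of class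
  \<open>C\<^sup>k\<close>. If \<open>m\<close> is the sine of the Gauss angle at distance \<open>y\<close> from the axis, then \<open>k\<^sub>1 = m / y\<close> and
  \<open>k\<^sub>2 = m' = k\<^sub>1 + y k\<^sub>1'\<close>. Put \<open>v = k\<^sub>1 - k\<^sub>1(0)\<close>. Since \<open>k\<^sub>1\<close> and \<open>k\<^sub>2\<close> have the same nonzero limit at \<open>p\<close>,
  the umbilic slope is \<open>1 + lim y v' / v\<close>, so \<open>\<mu> - 1\<close> is the order of vanishing of \<open>v\<close> at \<open>0\<close>: if
  \<open>\<mu> - 1 < s\<close>, then \<open>\<bar>v\<bar> y\<^sup>-\<^sup>s\<close> is eventually decreasing, hence bounded away from \<open>0\<close>. Since \<open>m\<close> is odd
  of class \<open>C\<^sup>2\<close> (respectively \<open>C\<^sup>3\<close>), Taylor's formula gives \<open>v = O(y)\<close> (respectively \<open>v = O(y\<^sup>2)\<close>).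
\<close>

subsection \<open>Functions of class \<open>C\<^sup>k\<close>\<close>

text \<open>Three features of the definitions shape the proof. \<open>S\<close> is given only by
  charts, so the profile must be built as a graph, and its smoothness and evenness established,
  before any Taylor expansion; evenness comes from the rotation by pi about the axis. The curvatures
  are defined through the derivative of \<open>N\<close> within \<open>S\<close>, which carries
  information only once \<open>N\<close> is known to be differentiable. Hence \<open>N\<close> is
  written near \<open>p\<close> as the restriction of an explicit function of the ambient
  coordinates; the axis needs its own argument, since the distance from the axis is not
  differentiable there. Finally, the slope is a limit in the Gauss angle along some unspecified
  parametrisation; injectivity of the sine of that angle near \<open>0\<close> carries it over to
  \<open>y\<close>, where the limit from the right suffices. Isolation of the umbilic enters through
  Rolle's theorem: a zero of \<open>v\<close> off the axis would force another umbilic closer to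
  \<open>p\<close>.\<close>

lemma Ck_on_cong:
  assumes "open U" "\<And>x. x \<in> U \<Longrightarrow> f x = g x" "Ck_on k f U"
  shows "Ck_on k g U"
  using assms(2,3)
proof (induction k arbitrary: f g)
  case 0
  then show ?case
    using continuous_on_cong[of U U f g] by simp
next
  case (Suc k)
  have eq: "frechet_derivative f (at x) = frechet_derivative g (at x)" if "x \<in> U" for x
  proof -
    have "f differentiable at x"
      using Suc.prems(2) that by (auto simp: differentiable_on_def at_within_open[OF _ \<open>open U\<close>])
    then show ?thesis
      using frechet_derivative_transform_within_open[OF _ \<open>open U\<close> that, of f g] Suc.prems(1) by blast
  qed
  have "g differentiable_on U"
    unfolding differentiable_on_def differentiable_def
  proof
    fix x assume "x \<in> U"
    obtain D where "(f has_derivative D) (at x within U)"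
      using Suc.prems(2) \<open>x \<in> U\<close> by (auto simp: differentiable_on_def differentiable_def)
    then show "\<exists>D. (g has_derivative D) (at x within U)"
      using has_derivative_transform[of x U g f] \<open>x \<in> U\<close> Suc.prems(1) by metis
  qed
  moreover have "Ck_on k (\<lambda>x. frechet_derivative g (at x) v) U" for v
    by (rule Suc.IH[of "\<lambda>x. frechet_derivative f (at x) v"]) (use Suc.prems(2) eq in auto)
  ultimately show ?case
    by simp
qed

text \<open>On an open set derivatives are unique, so smoothness may be checked on any explicitly
  known derivative \<open>D\<close> in place of the chosen
  \<open>frechet_derivative\<close>.\<close>

lemma Ck_on_SucI:
  assumes "open U" "\<And>x. x \<in> U \<Longrightarrow> (f has_derivative D x) (at x)" "\<And>v. Ck_on k (\<lambda>x. D x v) U"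
  shows "Ck_on (Suc k) f U"
proof -
  have "f differentiable_on U"
    using assms(2) unfolding differentiable_on_def differentiable_def
    by (meson has_derivative_at_withinI)
  moreover have "Ck_on k (\<lambda>x. frechet_derivative f (at x) v) U" for v
    by (rule Ck_on_cong[OF \<open>open U\<close> _ assms(3)[of v]]) (simp add: frechet_derivative_at[OF assms(2), symmetric])
  ultimately show ?thesis
    by simp
qed

lemma Ck_on_has_derivative:
  assumes "open U" "Ck_on (Suc k) f U" "x \<in> U"
  shows "(f has_derivative frechet_derivative f (at x)) (at x)"
  using assms(2,3)
  by (auto simp: differentiable_on_def at_within_open[OF _ assms(1)] simp flip: frechet_derivative_works)

lemma Ck_on_derivative:
  assumes "Ck_on (Suc k) f U"
  shows "Ck_on k (\<lambda>x. frechet_derivative f (at x) v) U"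
  using assms by simp

lemma Ck_on_Suc_imp:
  assumes "Ck_on (Suc k) f U"
  shows "Ck_on k f U"
  using assms
proof (induction k arbitrary: f)
  case 0
  then show ?case
    by (simp add: differentiable_imp_continuous_on)
next
  case (Suc k)
  have "f differentiable_on U" "\<And>v. Ck_on (Suc k) (\<lambda>x. frechet_derivative f (at x) v) U"
    using Suc.prems[unfolded Ck_on.simps(2)[of "Suc k" f]] by blast+
  then show ?case
    unfolding Ck_on.simps(2)[of k f] using Suc.IH by blast
qed

lemma Ck_on_le:
  assumes "Ck_on n f U" "k \<le> n"
  shows "Ck_on k f U"
  using assms(2,1) by (induction rule: inc_induct) (auto intro: Ck_on_Suc_imp simp del: Ck_on.simps)

lemma Ck_on_imp_continuous_on: "Ck_on k f U \<Longrightarrow> continuous_on U f"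
  using Ck_on_le[of k f U 0] by simp

lemma Ck_on_subset:
  assumes "Ck_on k f U" "V \<subseteq> U"
  shows "Ck_on k f V"
  using assms(1)
proof (induction k arbitrary: f)
  case 0
  then show ?case
    using assms(2) continuous_on_subset by auto
next
  case (Suc k)
  then show ?case
    using assms(2) by (auto intro: differentiable_on_subset)
qed

lemma Ck_on_linear_comp:
  assumes "open U" "bounded_linear l" "Ck_on k f U"
  shows "Ck_on k (\<lambda>x. l (f x)) U"
  using assms(3)
proof (induction k arbitrary: f)
  case 0
  then show ?case
    using assms(2) by (simp add: bounded_linear.continuous_on)
next
  case (Suc k)
  show ?case
  proof (rule Ck_on_SucI[OF \<open>open U\<close>])
    show "((\<lambda>x. l (f x)) has_derivative (\<lambda>v. l (frechet_derivative f (at x) v))) (at x)" if "x \<in> U" for x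
      using bounded_linear.has_derivative[OF assms(2) Ck_on_has_derivative[OF \<open>open U\<close> Suc.prems that]] .
    show "Ck_on k (\<lambda>x. l (frechet_derivative f (at x) v)) U" for v
      using Suc.IH Suc.prems by simp
  qed
qed

lemma Ck_on_add:
  assumes "open U" "Ck_on k f U" "Ck_on k g U"
  shows "Ck_on k (\<lambda>x. f x + g x) U"
  using assms(2,3)
proof (induction k arbitrary: f g)
  case 0
  then show ?case
    by (simp add: continuous_on_add)
next
  case (Suc k)
  show ?case
  proof (rule Ck_on_SucI[OF \<open>open U\<close>])
    show "((\<lambda>x. f x + g x) has_derivative
        (\<lambda>v. frechet_derivative f (at x) v + frechet_derivative g (at x) v)) (at x)" if "x \<in> U" for x
      using Suc.prems that by (intro has_derivative_add Ck_on_has_derivative[OF \<open>open U\<close>])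
    show "Ck_on k (\<lambda>x. frechet_derivative f (at x) v + frechet_derivative g (at x) v) U" for v
      using Suc.IH Suc.prems by simp
  qed
qed

lemma Ck_on_minus:
  assumes "open U" "Ck_on k f U"
  shows "Ck_on k (\<lambda>x. - f x) U"
  by (rule Ck_on_linear_comp[OF assms(1) _ assms(2)]) (rule bounded_linear_minus[OF bounded_linear_ident])

lemma Ck_on_mult:
  fixes f g :: "'a::euclidean_space \<Rightarrow> real"
  assumes "open U" "Ck_on k f U" "Ck_on k g U"
  shows "Ck_on k (\<lambda>x. f x * g x) U"
  using assms(2,3)
proof (induction k arbitrary: f g)
  case 0
  then show ?case
    by (simp add: continuous_on_mult)
next
  case (Suc k)
  show ?case
  proof (rule Ck_on_SucI[OF \<open>open U\<close>])
    show "((\<lambda>x. f x * g x) has_derivative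
        (\<lambda>v. f x * frechet_derivative g (at x) v + frechet_derivative f (at x) v * g x)) (at x)"
      if "x \<in> U" for x
      using Suc.prems that by (intro has_derivative_mult Ck_on_has_derivative[OF \<open>open U\<close>])
    show "Ck_on k (\<lambda>x. f x * frechet_derivative g (at x) v + frechet_derivative f (at x) v * g x) U" for v
      using Suc.prems[THEN Ck_on_Suc_imp] Suc.prems[THEN Ck_on_derivative, of v]
      by (intro Ck_on_add \<open>open U\<close> Suc.IH)
  qed
qed

lemma Ck_on_inverse:
  fixes f :: "'a::euclidean_space \<Rightarrow> real"
  assumes "open U" "Ck_on k f U" "\<And>x. x \<in> U \<Longrightarrow> f x \<noteq> 0"
  shows "Ck_on k (\<lambda>x. inverse (f x)) U"
  using assms(2)
proof (induction k)
  case 0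
  then show ?case
    using assms(3) by (simp add: continuous_on_inverse)
next
  case (Suc k)
  note IH = Suc.IH[OF Ck_on_Suc_imp[OF Suc.prems]]
  show ?case
  proof (rule Ck_on_SucI[OF \<open>open U\<close>])
    show "((\<lambda>x. inverse (f x)) has_derivative
        (\<lambda>v. - (inverse (f x) * frechet_derivative f (at x) v * inverse (f x)))) (at x)"
      if "x \<in> U" for x
      using Suc.prems that assms(3)
      by (intro Deriv.has_derivative_inverse Ck_on_has_derivative[OF \<open>open U\<close>])
    show "Ck_on k (\<lambda>x. - (inverse (f x) * frechet_derivative f (at x) v * inverse (f x))) U" for v
      using IH Suc.prems[THEN Ck_on_derivative, of v] by (intro Ck_on_minus Ck_on_mult \<open>open U\<close>)
  qed
qed

subsection \<open>Graph representation near the axis\<close>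

lemma plane_decomp: "v = v$1 *\<^sub>R axis 1 1 + v$2 *\<^sub>R axis 2 1" for v :: "real^2"
  by (simp add: vec_eq_iff forall_2 axis_def)

lemma has_real_derivative_along_curve:
  fixes G :: "real^2 \<Rightarrow> real"
  assumes "(G has_derivative G') (at (c y))" "(c has_vector_derivative w) (at y)"
  shows "((\<lambda>y. G (c y)) has_real_derivative w$1 * G' (axis 1 1) + w$2 * G' (axis 2 1)) (at y)"
proof -
  have "linear G'"
    using assms(1) has_derivative_linear by blast
  then have "G' w = w$1 * G' (axis 1 1) + w$2 * G' (axis 2 1)"
    by (subst plane_decomp[of w]) (simp add: linear_add linear_scale)
  moreover have "((\<lambda>y. G (c y)) has_vector_derivative G' w) (at y)"
    using vector_derivative_diff_chain_within[OF assms(2), of G G'] assms(1)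
    by (simp add: o_def has_derivative_at_withinI)
  ultimately show ?thesis
    by (simp add: has_real_derivative_iff_has_vector_derivative)
qed

text \<open>Cramer's rule expresses the velocity of \<open>c\<close> as a function of \<open>c\<close> itself that is only one
  order less smooth than \<open>P\<^sub>1, P\<^sub>2\<close>. Iterating this differential equation replaces the \<open>C\<^sup>k\<close> version of the
  inverse function theorem.\<close>

lemma iterated_derivatives_along_curve:
  fixes P1 P2 F :: "real^2 \<Rightarrow> real" and c :: "real \<Rightarrow> real^2"
  defines "J \<equiv> \<lambda>u. frechet_derivative P1 (at u) (axis 1 1) * frechet_derivative P2 (at u) (axis 2 1)
      - frechet_derivative P1 (at u) (axis 2 1) * frechet_derivative P2 (at u) (axis 1 1)"
  assumes "open U" and P1: "Ck_on k P1 U" and P2: "Ck_on k P2 U" and F: "Ck_on k F U"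
    and J: "\<And>u. u \<in> U \<Longrightarrow> J u \<noteq> 0"
    and "open I" and c: "\<And>y. y \<in> I \<Longrightarrow> c y \<in> U" "\<And>y. y \<in> I \<Longrightarrow> c differentiable at y"
      "\<And>y. y \<in> I \<Longrightarrow> P1 (c y) = 0" "\<And>y. y \<in> I \<Longrightarrow> P2 (c y) = y"
  obtains D :: "nat \<Rightarrow> real \<Rightarrow> real"
  where "D 0 = (\<lambda>y. F (c y))"
    and "\<And>j y. j < k \<Longrightarrow> y \<in> I \<Longrightarrow> (D j has_real_derivative D (Suc j) y) (at y)"
    and "continuous_on I (D k)"
proof -
  \<comment> \<open>\<open>L G\<close> is the derivative of \<open>G\<close> along the vector field
    (-d2 P1, d1 P1) / \<open>J\<close>, the unique field that annihilates \<open>P1\<close> and maps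
    \<open>P2\<close> to 1. It depends on \<open>u\<close> alone, so it can be iterated before
    restricting to the curve.\<close>
  define L where "L G u = (frechet_derivative P1 (at u) (axis 1 1) * frechet_derivative G (at u) (axis 2 1)
    - frechet_derivative P1 (at u) (axis 2 1) * frechet_derivative G (at u) (axis 1 1)) * inverse (J u)"
    for G :: "real^2 \<Rightarrow> real" and u
  have L: "((\<lambda>y. G (c y)) has_real_derivative L G (c y)) (at y)"
    if G: "Ck_on (Suc n) G U" and "0 < k" "y \<in> I" for G n y
  proof -
    obtain w where w: "(c has_vector_derivative w) (at y)"
      using c(2)[OF \<open>y \<in> I\<close>] vector_derivative_works by blast
    have P1': "Ck_on (Suc (k - 1)) P1 U" and P2': "Ck_on (Suc (k - 1)) P2 U"
      using P1 P2 \<open>0 < k\<close> by (simp_all del: Ck_on.simps)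
    note der = has_real_derivative_along_curve[OF Ck_on_has_derivative[OF \<open>open U\<close> _ c(1)[OF \<open>y \<in> I\<close>]] w]
    \<comment> \<open>Differentiating \<open>P1 (c y) = 0\<close> and \<open>P2 (c y) = y\<close>
      gives two linear equations for the velocity \<open>w\<close>, with determinant
      \<open>J (c y)\<close>.\<close>
    have "((\<lambda>y. P1 (c y)) has_real_derivative 0) (at y)"
      by (rule has_field_derivative_transform_within_open[OF _ \<open>open I\<close> \<open>y \<in> I\<close>, where f = "\<lambda>_. 0"])
        (simp_all add: c(3))
    then have eq1: "w$1 * frechet_derivative P1 (at (c y)) (axis 1 1)
        + w$2 * frechet_derivative P1 (at (c y)) (axis 2 1) = 0"
      using der[OF P1'] DERIV_unique by blast
    have "((\<lambda>y. P2 (c y)) has_real_derivative 1) (at y)"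
      by (rule has_field_derivative_transform_within_open[OF _ \<open>open I\<close> \<open>y \<in> I\<close>, where f = "\<lambda>t. t"])
        (simp_all add: c(4))
    then have eq2: "w$1 * frechet_derivative P2 (at (c y)) (axis 1 1)
        + w$2 * frechet_derivative P2 (at (c y)) (axis 2 1) = 1"
      using der[OF P2'] DERIV_unique by blast
    have J0: "J (c y) \<noteq> 0"
      using J c(1) \<open>y \<in> I\<close> by blast
    have "w$1 * J (c y) = - frechet_derivative P1 (at (c y)) (axis 2 1)"
      unfolding J_def using eq1 eq2 by algebra
    then have "w$1 = - frechet_derivative P1 (at (c y)) (axis 2 1) * inverse (J (c y))"
      using J0 by (simp add: field_simps)
    moreover have "w$2 * J (c y) = frechet_derivative P1 (at (c y)) (axis 1 1)"
      unfolding J_def using eq1 eq2 by algebra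
    then have "w$2 = frechet_derivative P1 (at (c y)) (axis 1 1) * inverse (J (c y))"
      using J0 by (simp add: field_simps)
    ultimately show ?thesis
      using der[OF G] by (simp add: L_def algebra_simps)
  qed
  \<comment> \<open>Each \<open>L\<close> costs one derivative of its argument. Its coefficients
    have class \<open>k - 1\<close>, which is never less than the remaining class
    \<open>k - Suc j\<close>.\<close>
  have smooth: "Ck_on (k - j) ((L ^^ j) F) U" if "j \<le> k" for j
    using that
  proof (induction j)
    case 0
    then show ?case
      using F by simp
  next
    case (Suc j)
    define n where "n = k - Suc j"
    have n: "k - j = Suc n" "k - Suc j = n" "n \<le> k - 1"
      using Suc.prems by (auto simp: n_def)
    have part: "Ck_on n (\<lambda>u. frechet_derivative Q (at u) v) U" if "Ck_on k Q U" for Q :: "real^2 \<Rightarrow> real" and v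
      using n Suc.prems by (intro Ck_on_derivative, intro Ck_on_le[OF that]) auto
    have partF: "Ck_on n (\<lambda>u. frechet_derivative ((L ^^ j) F) (at u) v) U" for v
      using Suc n by (intro Ck_on_derivative) (simp del: Ck_on.simps)
    have "Ck_on n J U"
      unfolding J_def diff_conv_add_uminus
      by (intro Ck_on_add Ck_on_mult Ck_on_minus \<open>open U\<close> part P1 P2)
    then have "Ck_on n (L X) U" if "\<And>v. Ck_on n (\<lambda>u. frechet_derivative X (at u) v) U" for X
      unfolding L_def diff_conv_add_uminus
      by (intro Ck_on_add Ck_on_mult Ck_on_minus Ck_on_inverse \<open>open U\<close> part P1 that J)
    from this[OF partF] show ?case
      using n by simp
  qed
  have cont_c: "continuous_on I c"
    using c(2) by (meson continuous_at_imp_continuous_on differentiable_imp_continuous_within)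
  show thesis
  proof (rule that[of "\<lambda>j y. (L ^^ j) F (c y)"])
    show "((\<lambda>y. (L ^^ j) F (c y)) has_real_derivative (L ^^ Suc j) F (c y)) (at y)"
      if "j < k" "y \<in> I" for j y
      using L[of "k - Suc j" "(L ^^ j) F" y] smooth[of j] that by (simp add: Suc_diff_Suc del: Ck_on.simps)
    show "continuous_on I (\<lambda>y. (L ^^ k) F (c y))"
      using smooth[of k] c(1) by (intro continuous_on_compose2[OF _ cont_c]) auto
  qed simp
qed

text \<open>The inverse function theorem, with bounded linear maps translated back to
  \<open>frechet_derivative\<close>. For the inverse only differentiability is recorded, which is
  all that the differential equation along the curve requires.\<close>

lemma Ck_on_local_inverse:
  fixes P :: "'a::euclidean_space \<Rightarrow> 'a"
  assumes "open U" and P: "Ck_on (Suc k) P U" and "u0 \<in> U" and "inj (frechet_derivative P (at u0))"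
  obtains U' W G where "open U'" "U' \<subseteq> U" "u0 \<in> U'" "open W" "P u0 \<in> W" "homeomorphism U' W P G"
    and "\<And>w. w \<in> W \<Longrightarrow> G differentiable at w"
    and "\<And>u. u \<in> U' \<Longrightarrow> inj (frechet_derivative P (at u))"
proof -
  define f' where "f' u = Blinfun (frechet_derivative P (at u))" for u
  have der: "(P has_derivative frechet_derivative P (at u)) (at u)" if "u \<in> U" for u
    by (rule Ck_on_has_derivative[OF \<open>open U\<close> P that])
  have f': "blinfun_apply (f' u) = frechet_derivative P (at u)" if "u \<in> U" for u
    unfolding f'_def using der[OF that] has_derivative_bounded_linear bounded_linear_Blinfun_apply by blast
  have cont: "continuous_on U f'"
  \<comment> \<open>In finite dimension continuity of each directional derivative already gives
    continuity in the operator norm.\<close>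
  proof (rule continuous_on_blinfun_componentwise)
    fix i :: 'a
    have "continuous_on U (\<lambda>u. frechet_derivative P (at u) i)"
      by (rule Ck_on_imp_continuous_on[OF Ck_on_derivative[OF P]])
    then show "continuous_on U (\<lambda>u. f' u i)"
      using continuous_on_cong[of U U "\<lambda>u. f' u i" "\<lambda>u. frechet_derivative P (at u) i"] f' by simp
  qed
  have lin0: "linear (frechet_derivative P (at u0))"
    using der[OF \<open>u0 \<in> U\<close>] has_derivative_linear by blast
  obtain g where g: "linear g" "g \<circ> frechet_derivative P (at u0) = id"
    using linear_injective_left_inverse[OF lin0 assms(4)] by blast
  have inv: "Blinfun g o\<^sub>L f' u0 = id_blinfun"
  proof (rule blinfun_eqI)
    fix v
    have "blinfun_apply (Blinfun g) = g"
      using g(1) bounded_linear_Blinfun_apply linear_conv_bounded_linear by blast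
    then show "blinfun_apply (Blinfun g o\<^sub>L f' u0) v = blinfun_apply id_blinfun v"
      using fun_cong[OF g(2), of v] f'[OF \<open>u0 \<in> U\<close>] by simp
  qed
  have derB: "(P has_derivative blinfun_apply (f' u)) (at u)" if "u \<in> U" for u
    using der[OF that] f'[OF that] by simp
  show thesis
  proof (rule inverse_function_theorem[OF \<open>open U\<close> derB cont \<open>u0 \<in> U\<close> inv])
    fix U' W G G'
    assume *: "open U'" "U' \<subseteq> U" "u0 \<in> U'" "open W" "P u0 \<in> W" "homeomorphism U' W P G"
      and G': "\<And>y. y \<in> W \<Longrightarrow> (G has_derivative (G' y)) (at y)"
      and bij: "\<And>y. y \<in> W \<Longrightarrow> bij (blinfun_apply (f'(G y)))"
    show thesis
    proof (rule that[OF *])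
      show "G differentiable at w" if "w \<in> W" for w
        using G'[OF that] differentiableI by blast
      show "inj (frechet_derivative P (at u))" if "u \<in> U'" for u
      proof -
        have "P u \<in> W" "G (P u) = u"
          using *(6) that by (auto simp: homeomorphism_def)
        then show ?thesis
          using bij[of "P u"] f'[of u] subsetD[OF *(2) that] by (simp add: bij_def)
      qed
    qed
  qed
qed

lemma jacobian_nonzero:
  fixes f :: "real^2 \<Rightarrow> real^2"
  assumes "linear f" "inj f"
  shows "f (axis 1 1) $ 1 * f (axis 2 1) $ 2 - f (axis 2 1) $ 1 * f (axis 1 1) $ 2 \<noteq> 0"
  using det_nz_iff_inj[OF assms(1)] assms(2) by (simp add: det_2 matrix_def)

text \<open>The chart carries the line \<open>u + t e\<close> to a curve in \<open>S\<close> with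
  velocity \<open>D e\<close>.\<close>

lemma chart_derivative_tangent:
  assumes "open U" "u \<in> U" "(\<phi> has_derivative D) (at u)" "\<phi> ` U \<subseteq> S"
  shows "D e \<in> tangent_space S (\<phi> u)"
proof -
  define \<gamma> where "\<gamma> t = \<phi> (u + t *\<^sub>R e)" for t :: real
  have "((\<lambda>t. u + t *\<^sub>R e) \<longlongrightarrow> u + 0 *\<^sub>R e) (nhds (0::real))"
    by (intro tendsto_intros filterlim_ident)
  then have "\<forall>\<^sub>F t in nhds (0::real). u + t *\<^sub>R e \<in> U"
    using assms(1,2) topological_tendstoD by fastforce
  then have "\<forall>\<^sub>F t in nhds 0. \<gamma> t \<in> S"
    by (rule eventually_mono) (use assms(4) \<gamma>_def in auto)
  moreover have "((\<lambda>t. u + t *\<^sub>R e) has_vector_derivative e) (at 0)"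
    by (auto intro!: derivative_eq_intros)
  then have "(\<gamma> has_vector_derivative D e) (at 0)"
    using vector_derivative_diff_chain_within[of "\<lambda>t. u + t *\<^sub>R e" e 0 UNIV \<phi> D] assms(3)
    by (simp add: o_def \<gamma>_def[abs_def] has_derivative_at_withinI)
  moreover have "\<gamma> 0 = \<phi> u"
    by (simp add: \<gamma>_def)
  ultimately show ?thesis
    unfolding tangent_space_def by blast
qed

lemma axis_orientation_nth:
  assumes "axis_orientation a"
  shows "a$1 = 0" "a$2 = 0" "a$3 * a$3 = 1"
  using assms by (auto simp: axis_orientation_def axis_def)

lemma profile_point_nth:
  assumes "axis_orientation a"
  shows "profile_point a y z $ 1 = 0" "profile_point a y z $ 2 = y" "profile_point a y z $ 3 = z * a$3"
  using axis_orientation_nth[OF assms] by (simp_all add: profile_point_def axis_def)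

lemma inner_axis_orientation:
  assumes "axis_orientation a"
  shows "x \<bullet> a = x$3 * a$3"
  using axis_orientation_nth[OF assms] by (simp add: inner_vec_def sum_3)

lemma eq_profile_pointI:
  assumes "axis_orientation a" "x$1 = 0" "x$2 = y"
  shows "x = profile_point a y (x \<bullet> a)"
  using axis_orientation_nth(3)[OF assms(1)] assms
  by (simp add: vec_eq_iff forall_3 profile_point_nth inner_axis_orientation mult.assoc)

lemma profile_point_inner:
  assumes "axis_orientation a"
  shows "profile_point a y z \<bullet> a = z"
  using axis_orientation_nth(3)[OF assms]
  by (simp add: profile_point_nth[OF assms] inner_axis_orientation[OF assms] mult.assoc)

text \<open>Because the tangent plane at \<open>p\<close> is orthogonal to \<open>a\<close>, the
  horizontal projection \<open>P\<close> of a chart is a local diffeomorphism. The profile is the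
  height of the chart along the \<open>P\<close>-preimage of the y-axis. Uniqueness in the ball is
  part of the conclusion, since symmetry and the comparison with other parametrisations rest on
  it.\<close>

lemma profile_graph:
  assumes surf: "regular_surface k S" and "0 < k" and p: "p \<in> S" "p \<in> z_axis" and a: "axis_orientation a"
    and normal: "\<And>v. v \<in> tangent_space S p \<Longrightarrow> a \<bullet> v = 0"
  obtains \<delta> :: real and D :: "nat \<Rightarrow> real \<Rightarrow> real" where "0 < \<delta>"
    and "\<And>y. \<bar>y\<bar> < \<delta> \<Longrightarrow> profile_point a y (D 0 y) \<in> S"
    and "\<And>y z. profile_point a y z \<in> S \<inter> ball p \<delta> \<Longrightarrow> z = D 0 y"
    and "\<And>j y. j < k \<Longrightarrow> \<bar>y\<bar> < \<delta> \<Longrightarrow> (D j has_real_derivative D (Suc j) y) (at y)"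
    and "continuous_on {-\<delta><..<\<delta>} (D k)"
proof -
  obtain U :: "(real^2) set" and V \<phi> \<psi> where "open U" "open V" "p \<in> V"
    and hom: "homeomorphism U (S \<inter> V) \<phi> \<psi>" and \<phi>: "Ck_on k \<phi> U"
    and inj: "\<And>u. u \<in> U \<Longrightarrow> inj (frechet_derivative \<phi> (at u))"
    using surf p(1) unfolding regular_surface_def by metis
  obtain k' where k': "k = Suc k'"
    using \<open>0 < k\<close> gr0_conv_Suc by blast
  define hp :: "real^3 \<Rightarrow> real^2" where "hp x = x$1 *\<^sub>R axis 1 1 + x$2 *\<^sub>R axis 2 1" for x
  have hp_nth: "hp x $ 1 = x$1" "hp x $ 2 = x$2" for x
    by (simp_all add: hp_def axis_def)
  have hp_linear: "bounded_linear hp"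
    unfolding hp_def[abs_def] by (intro bounded_linear_intros bounded_linear_vec_nth)
  define P where "P u = hp (\<phi> u)" for u
  define u0 where "u0 = \<psi> p"
  have u0: "u0 \<in> U" "\<phi> u0 = p"
    using hom p(1) \<open>p \<in> V\<close> by (auto simp: u0_def homeomorphism_def)
  have P: "Ck_on k P U"
    unfolding P_def[abs_def] by (rule Ck_on_linear_comp[OF \<open>open U\<close> hp_linear \<phi>])
  have der_\<phi>: "(\<phi> has_derivative frechet_derivative \<phi> (at u)) (at u)" if "u \<in> U" for u
    using Ck_on_has_derivative[OF \<open>open U\<close> \<phi>[unfolded k'] that] .
  have P_der: "frechet_derivative P (at u) = (\<lambda>v. hp (frechet_derivative \<phi> (at u) v))" if "u \<in> U" for u
    using bounded_linear.has_derivative[OF hp_linear der_\<phi>[OF that]]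
    unfolding P_def[abs_def] by (rule frechet_derivative_at[symmetric])
  have lin_P: "linear (frechet_derivative P (at u))" if "u \<in> U" for u
    using Ck_on_has_derivative[OF \<open>open U\<close> P[unfolded k'] that] has_derivative_linear by blast
  have "inj (frechet_derivative P (at u0))"
    unfolding linear_injective_0[OF lin_P[OF u0(1)]]
  proof (intro allI impI)
    fix e assume e: "frechet_derivative P (at u0) e = 0"
    define v where "v = frechet_derivative \<phi> (at u0) e"
    have "hp v = 0"
      using e P_der[OF u0(1)] by (simp add: v_def)
    then have "v$1 = 0" "v$2 = 0"
      using hp_nth[of v] by simp_all
    \<comment> \<open>A kernel vector of the projected derivative comes from a \<open>v\<close> that
      is both vertical and tangent, hence zero.\<close>
    moreover have "v \<in> tangent_space S p"
      using chart_derivative_tangent[OF \<open>open U\<close> u0(1) der_\<phi>[OF u0(1)], of S e] hom u0(2)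
      by (auto simp: homeomorphism_def v_def)
    then have "v \<bullet> a = 0"
      using normal inner_commute[of v a] by simp
    then have "v$3 = 0"
      using axis_orientation_nth(3)[OF a] inner_axis_orientation[OF a, of v] by auto
    ultimately have "v = 0"
      by (simp add: vec_eq_iff forall_3)
    then show "e = 0"
      using inj[OF u0(1)] linear_injective_0[OF has_derivative_linear[OF der_\<phi>[OF u0(1)]]]
      by (simp add: v_def)
  qed
  from Ck_on_local_inverse[OF \<open>open U\<close> P[unfolded k'] u0(1) this]
  obtain U' W G where "open U'" "U' \<subseteq> U" "u0 \<in> U'" "open W" "P u0 \<in> W" and homP: "homeomorphism U' W P G"
    and G: "\<And>w. w \<in> W \<Longrightarrow> G differentiable at w"
    and injP: "\<And>u. u \<in> U' \<Longrightarrow> inj (frechet_derivative P (at u))"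
    by blast
  \<comment> \<open>The chart is a homeomorphism onto its image, so points of \<open>S\<close> close
    to \<open>p\<close> have parameters in \<open>U'\<close>. This excludes a second sheet of
    \<open>S\<close> near \<open>p\<close> and yields uniqueness of the graph.\<close>
  have "continuous_on (S \<inter> V) \<psi>"
    using hom by (simp add: homeomorphism_def)
  then obtain T where "open T" and T: "T \<inter> (S \<inter> V) = \<psi> -` U' \<inter> (S \<inter> V)"
    using \<open>open U'\<close> unfolding continuous_on_open_invariant by blast
  have "p \<in> T \<inter> V"
    using T p(1) \<open>p \<in> V\<close> \<open>u0 \<in> U'\<close> u0_def by blast
  then obtain d1 where "d1 > 0" and d1: "ball p d1 \<subseteq> T \<inter> V"
    using open_contains_ball[of "T \<inter> V"] \<open>open T\<close> \<open>open V\<close> by blast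
  have "P u0 = 0"
    using p(2) by (simp add: P_def u0(2) vec_eq_iff forall_2 hp_nth z_axis_def)
  then obtain d2 where "d2 > 0" and d2: "ball 0 d2 \<subseteq> W"
    using open_contains_ball \<open>open W\<close> \<open>P u0 \<in> W\<close> by metis
  define \<delta> where "\<delta> = min d1 d2"
  have "\<delta> > 0"
    using \<open>d1 > 0\<close> \<open>d2 > 0\<close> by (simp add: \<delta>_def)
  define c where "c y = G (y *\<^sub>R axis 2 1)" for y :: real
  have W: "y *\<^sub>R axis 2 1 \<in> W" if "\<bar>y\<bar> < \<delta>" for y
    using d2 that by (auto simp: \<delta>_def)
  have c: "c y \<in> U'" "P (c y) = y *\<^sub>R axis 2 1" if "\<bar>y\<bar> < \<delta>" for y
    using homP W[OF that] by (auto simp: homeomorphism_def c_def)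
  have c_diff: "c differentiable at y" if "\<bar>y\<bar> < \<delta>" for y
    unfolding c_def[abs_def]
    by (rule differentiable_compose[where f = G]) (use G[OF W[OF that]] in simp_all)
  define F where "F u = \<phi> u \<bullet> a" for u
  have comp: "frechet_derivative (\<lambda>u. P u $ i) (at u) = (\<lambda>v. frechet_derivative P (at u) v $ i)"
    if "u \<in> U" for u i
    by (rule frechet_derivative_at[symmetric])
      (rule bounded_linear.has_derivative[OF bounded_linear_vec_nth
        Ck_on_has_derivative[OF \<open>open U\<close> P[unfolded k'] that]])
  obtain D where D: "D 0 = (\<lambda>y. F (c y))"
    "\<And>j y. j < k \<Longrightarrow> y \<in> {-\<delta><..<\<delta>} \<Longrightarrow> (D j has_real_derivative D (Suc j) y) (at y)"
    "continuous_on {-\<delta><..<\<delta>} (D k)"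
  proof (rule iterated_derivatives_along_curve[of U' k "\<lambda>u. P u $ 1" "\<lambda>u. P u $ 2" F "{-\<delta><..<\<delta>}" c])
    show "Ck_on k (\<lambda>u. P u $ 1) U'" "Ck_on k (\<lambda>u. P u $ 2) U'"
      by (rule Ck_on_subset[OF Ck_on_linear_comp[OF \<open>open U\<close> bounded_linear_vec_nth P] \<open>U' \<subseteq> U\<close>])+
    show "Ck_on k F U'"
      unfolding F_def[abs_def]
      by (rule Ck_on_subset[OF Ck_on_linear_comp[OF \<open>open U\<close> bounded_linear_inner_left \<phi>] \<open>U' \<subseteq> U\<close>])
    show "frechet_derivative (\<lambda>u. P u $ 1) (at u) (axis 1 1) * frechet_derivative (\<lambda>u. P u $ 2) (at u) (axis 2 1)
      - frechet_derivative (\<lambda>u. P u $ 1) (at u) (axis 2 1) * frechet_derivative (\<lambda>u. P u $ 2) (at u) (axis 1 1) \<noteq> 0"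
      if "u \<in> U'" for u
      using jacobian_nonzero[OF lin_P injP[OF that]] that \<open>U' \<subseteq> U\<close> comp by auto
  qed (use c c_diff \<open>open U'\<close> in \<open>auto simp: abs_less_iff axis_def\<close>)
  show thesis
  proof (rule that[OF \<open>\<delta> > 0\<close>])
    show "profile_point a y (D 0 y) \<in> S" if "\<bar>y\<bar> < \<delta>" for y
    proof -
      have "\<phi> (c y) $ 1 = 0" "\<phi> (c y) $ 2 = y"
        using c(2)[OF that] hp_nth[of "\<phi> (c y)"] by (simp_all add: P_def axis_def)
      then have "profile_point a y (D 0 y) = \<phi> (c y)"
        using eq_profile_pointI[OF a] D(1) F_def by simp
      then show ?thesis
        using c(1)[OF that] \<open>U' \<subseteq> U\<close> hom by (auto simp: homeomorphism_def)
    qed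
    show "z = D 0 y" if x: "profile_point a y z \<in> S \<inter> ball p \<delta>" for y z
    proof -
      define x where "x = profile_point a y z"
      have xSV: "x \<in> S \<inter> V" "x \<in> T"
        using x d1 by (auto simp: \<delta>_def x_def)
      then have "\<psi> x \<in> U'"
        using T by blast
      with xSV have "\<phi> (\<psi> x) = x" "G (P (\<psi> x)) = \<psi> x"
        using hom homP by (auto simp: homeomorphism_def)
      moreover have "hp x = y *\<^sub>R axis 2 1"
        by (simp add: x_def hp_def profile_point_nth[OF a])
      ultimately have "\<phi> (c y) = x"
        by (simp add: P_def c_def)
      then show ?thesis
        using profile_point_inner[OF a, of y z] by (simp add: D(1) F_def x_def)
    qed
  qed (use D in \<open>auto simp: abs_less_iff\<close>)
qed

subsection \<open>Order of vanishing and the umbilic slope\<close>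

text \<open>For \<open>L < s < n\<close> the upper bound gives \<open>\<bar>v\<bar>\<close> y^(-s)
  at most \<open>C\<close> y^(n-s), which tends to 0, against the positive lower bound obtained from
  monotonicity.\<close>

lemma growth_exponent_le:
  fixes v v' :: "real \<Rightarrow> real"
  assumes "0 < \<delta>"
    and der: "\<And>y. 0 < y \<Longrightarrow> y < \<delta> \<Longrightarrow> (v has_real_derivative v' y) (at y)"
    and nz: "\<And>y. 0 < y \<Longrightarrow> y < \<delta> \<Longrightarrow> v y \<noteq> 0"
    and lim: "((\<lambda>y. y * v' y / v y) \<longlongrightarrow> L) (at_right 0)"
    and bound: "\<And>y. 0 < y \<Longrightarrow> y < \<delta> \<Longrightarrow> \<bar>v y\<bar> \<le> C * y ^ n"
  shows "real n \<le> L"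
proof (rule ccontr)
  assume "\<not> real n \<le> L"
  then obtain s where s: "L < s" "s < real n"
    using dense[of L "real n"] by auto
  have "\<forall>\<^sub>F y in at_right 0. y * v' y / v y < s"
    using order_tendstoD(2)[OF lim s(1)] .
  then obtain b where "b > 0" and b: "\<And>y. 0 < y \<Longrightarrow> y < b \<Longrightarrow> y * v' y / v y < s"
    unfolding eventually_at_right_field by auto
  define y0 where "y0 = min b \<delta> / 2"
  have y0: "0 < y0" "y0 < b" "y0 < \<delta>"
    using \<open>b > 0\<close> \<open>\<delta> > 0\<close> by (auto simp: y0_def min_def)
  define w where "w y = (v y)\<^sup>2 * y powr (- 2 * s)" for y
  have dec: "w y0 \<le> w y" if "0 < y" "y < y0" for y
  proof (rule DERIV_nonpos_imp_nonincreasing[OF less_imp_le[OF \<open>y < y0\<close>]])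
    fix x assume "y \<le> x" "x \<le> y0"
    then have x: "0 < x" "x < \<delta>" "x < b"
      using that y0 by auto
    define q where "q = 2 * (v x)\<^sup>2 * x powr (- 2 * s) / x * (x * v' x / v x - s)"
    have "(w has_real_derivative q) (at x)"
      unfolding w_def[abs_def] q_def
      by (rule derivative_eq_intros refl der x)+
        (use x nz[OF x(1,2)] in \<open>simp add: field_simps power2_eq_square powr_diff\<close>)
    moreover have "q \<le> 0"
      unfolding q_def using b[OF x(1,3)] x by (intro mult_nonneg_nonpos) auto
    ultimately show "\<exists>q. (w has_real_derivative q) (at x) \<and> q \<le> 0"
      by blast
  qed
  have "((\<lambda>y::real. y powr (2 * real n - 2 * s)) \<longlongrightarrow> 0) (at_right 0)"
    by (rule tendsto_zero_powrI[OF tendsto_ident_at tendsto_const])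
      (use s(2) in \<open>auto simp: eventually_at_filter\<close>)
  then have "((\<lambda>y::real. C\<^sup>2 * y powr (2 * real n - 2 * s)) \<longlongrightarrow> C\<^sup>2 * 0) (at_right 0)"
    by (rule tendsto_mult_left)
  moreover have "w y0 \<le> C\<^sup>2 * y powr (2 * real n - 2 * s)" if y: "0 < y" "y < y0" for y
  proof -
    have "w y0 \<le> w y"
      by (rule dec[OF y])
    also have "(v y)\<^sup>2 \<le> (C * y ^ n)\<^sup>2"
      using bound[of y] y y0 by (metis abs_ge_zero less_trans power2_abs power_mono)
    then have "w y \<le> (C * y ^ n)\<^sup>2 * y powr (- 2 * s)"
      unfolding w_def by (intro mult_right_mono) auto
    also have "\<dots> = C\<^sup>2 * y powr (2 * real n - 2 * s)"
    proof -
      have "(y ^ n)\<^sup>2 = y powr (2 * real n)"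
        using y by (simp add: powr_realpow[symmetric] power2_eq_square flip: powr_add)
      moreover have "y powr (2 * real n) * y powr (- 2 * s) = y powr (2 * real n - 2 * s)"
        by (simp flip: powr_add)
      ultimately show ?thesis
        by (simp add: power_mult_distrib mult.assoc)
    qed
    finally show ?thesis .
  qed
  then have "\<forall>\<^sub>F y in at_right 0. w y0 \<le> C\<^sup>2 * y powr (2 * real n - 2 * s)"
    unfolding eventually_at_right_field using y0(1) by blast
  ultimately have "w y0 \<le> C\<^sup>2 * 0"
    by (intro tendsto_lowerbound) auto
  moreover have "w y0 > 0"
    using nz[OF y0(1,3)] y0(1) by (simp add: w_def)
  ultimately show False
    by simp
qed

lemma umbilic_slope_bound:
  fixes m m' :: "real \<Rightarrow> real"
  assumes "0 < \<delta>" "1 \<le> n"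
    and der: "\<And>y. \<bar>y\<bar> < \<delta> \<Longrightarrow> (m has_real_derivative m' y) (at y)"
    and cont: "isCont m' 0" and "m 0 = 0" and "m' 0 \<noteq> 0"
    and bound: "\<And>y. 0 < y \<Longrightarrow> y < \<delta> \<Longrightarrow> \<bar>m y - m' 0 * y\<bar> \<le> C * y ^ n"
    and not_umbilic: "\<And>y. 0 < y \<Longrightarrow> y < \<delta> \<Longrightarrow> m' y \<noteq> m y / y"
    and lim: "((\<lambda>y. (1 / m' y - 1 / m' 0) / (1 / (m y / y) - 1 / m' 0)) \<longlongrightarrow> \<mu>) (at_right 0)"
  shows "real n \<le> \<mu>"
proof -
  \<comment> \<open>The value at \<open>0\<close> is the limit, so \<open>v\<close> is continuous on
    closed intervals starting at \<open>0\<close>, as Rolle's theorem requires.\<close>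
  define v where "v y = (if y = 0 then 0 else m y / y - m' 0)" for y
  define v' where "v' y = (m' y - m y / y) / y" for y
  have der_v: "(v has_real_derivative v' y) (at y)" if "0 < y" "y < \<delta>" for y
  proof (rule has_field_derivative_transform_within_open[of "\<lambda>y. m y / y - m' 0" _ _ "{0<..}"])
    show "((\<lambda>y. m y / y - m' 0) has_real_derivative v' y) (at y)"
      using that by (auto intro!: derivative_eq_intros der simp: v'_def field_simps power2_eq_square)
  qed (use that in \<open>auto simp: v_def\<close>)
  have "((\<lambda>y. m y / y) \<longlongrightarrow> m' 0) (at 0)"
    using der[of 0] \<open>0 < \<delta>\<close> \<open>m 0 = 0\<close> by (simp add: has_field_derivative_iff)
  then have "((\<lambda>y. m y / y - m' 0) \<longlongrightarrow> m' 0 - m' 0) (at 0)"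
    by (intro tendsto_intros)
  then have lim_v: "(v \<longlongrightarrow> 0) (at 0)"
    by (simp add: Lim_transform_eventually v_def[abs_def] eventually_at_filter)
  \<comment> \<open>If \<open>v y = 0 = v 0\<close>, Rolle gives \<open>z\<close> in between with
    \<open>v' z = 0\<close>, that is \<open>m' z = m z / z\<close>: an umbilic.\<close>
  have nz: "v y \<noteq> 0" if y: "0 < y" "y < \<delta>" for y
  proof
    assume "v y = 0"
    have "continuous_on {0..y} v"
    proof (rule continuous_at_imp_continuous_on, rule ballI)
      fix x assume "x \<in> {0..y}"
      show "isCont v x"
      proof (cases "x = 0")
        case True
        then show ?thesis
          using lim_v by (simp add: isCont_def v_def)
      next
        case False
        then show ?thesis
          using der_v[of x] \<open>x \<in> {0..y}\<close> y DERIV_isCont by fastforce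
      qed
    qed
    moreover have "v differentiable (at x)" if "0 < x" "x < y" for x
      using der_v[of x] that y real_differentiable_def by fastforce
    ultimately obtain z where z: "0 < z" "z < y" "(v has_real_derivative 0) (at z)"
      using Rolle[of 0 y v] \<open>v y = 0\<close> y by (auto simp: v_def)
    then have "v' z = 0"
      using der_v[of z] y DERIV_unique by fastforce
    then show False
      using not_umbilic[of z] z y by (simp add: v'_def)
  qed
  have near: "\<forall>\<^sub>F y in at_right 0. 0 < y \<and> y < \<delta>"
    using \<open>0 < \<delta>\<close> unfolding eventually_at_right_field by blast
  have lim1: "((\<lambda>y. m y / y) \<longlongrightarrow> m' 0) (at_right 0)"
    using \<open>((\<lambda>y. m y / y) \<longlongrightarrow> m' 0) (at 0)\<close> by (rule filterlim_mono) (auto simp: at_le)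
  have lim2: "(m' \<longlongrightarrow> m' 0) (at_right 0)"
    using cont unfolding isCont_def by (rule filterlim_mono) (auto simp: at_le)
  \<comment> \<open>The extra factor \<open>k2 / k1\<close> tends to 1 and turns the quotient of
    differences of radii into \<open>(k2 - k0) / (k1 - k0)\<close>. Subtracting 1 leaves
    \<open>(k2 - k1) / (k1 - k0)\<close>, where \<open>k2 - k1 = y * v' y\<close>.\<close>
  have "((\<lambda>y. (1 / m' y - 1 / m' 0) / (1 / (m y / y) - 1 / m' 0) * (m' y / (m y / y)) - 1) \<longlongrightarrow>
      \<mu> * (m' 0 / m' 0) - 1) (at_right 0)"
    by (intro tendsto_intros lim lim1 lim2 \<open>m' 0 \<noteq> 0\<close>)
  moreover have "\<forall>\<^sub>F y in at_right 0.
      (1 / m' y - 1 / m' 0) / (1 / (m y / y) - 1 / m' 0) * (m' y / (m y / y)) - 1 = y * v' y / v y"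
    using near tendsto_imp_eventually_ne[OF lim1 \<open>m' 0 \<noteq> 0\<close>] tendsto_imp_eventually_ne[OF lim2 \<open>m' 0 \<noteq> 0\<close>]
  proof eventually_elim
    case (elim y)
    define k0 where "k0 = m' 0"
    define k1 where "k1 = m y / y"
    define k2 where "k2 = m' y"
    have "k0 \<noteq> 0" "k1 \<noteq> 0" "k2 \<noteq> 0" "k1 - k0 \<noteq> 0"
      using elim nz[of y] \<open>m' 0 \<noteq> 0\<close> by (auto simp: k0_def k1_def k2_def v_def)
    then have "(1 / k2 - 1 / k0) / (1 / k1 - 1 / k0) * (k2 / k1) - 1 = (k2 - k1) / (k1 - k0)"
      by (simp add: divide_simps) (simp add: algebra_simps)
    then show ?case
      using elim by (simp add: v_def v'_def k0_def k1_def k2_def)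
  qed
  ultimately have lim': "((\<lambda>y. y * v' y / v y) \<longlongrightarrow> \<mu> - 1) (at_right 0)"
    using \<open>m' 0 \<noteq> 0\<close> by (simp add: tendsto_cong)
  \<comment> \<open>One power is lost because \<open>v\<close> is the remainder of \<open>m\<close>
    divided by \<open>y\<close>; the summand 1 in the slope restores it.\<close>
  have "real (n - 1) \<le> \<mu> - 1"
  proof (rule growth_exponent_le[OF \<open>0 < \<delta>\<close> der_v nz lim'])
    fix y assume y: "0 < y" "y < \<delta>"
    have "y ^ n = y * y ^ (n - 1)"
      using \<open>1 \<le> n\<close> by (simp flip: power_Suc)
    moreover have "\<bar>v y\<bar> * y = \<bar>m y - m' 0 * y\<bar>"
      using y by (simp add: v_def abs_mult_pos[symmetric] field_simps flip: abs_mult_pos)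
    ultimately have "\<bar>v y\<bar> * y \<le> (C * y ^ (n - 1)) * y"
      using bound[OF y] by (simp add: mult_ac)
    then show "\<bar>v y\<bar> \<le> C * y ^ (n - 1)"
      using y by simp
  qed
  then show ?thesis
    using \<open>1 \<le> n\<close> by (simp add: of_nat_diff)
qed

lemma iterated_derivatives_parity:
  fixes D :: "nat \<Rightarrow> real \<Rightarrow> real"
  assumes der: "\<And>j y. j < k \<Longrightarrow> \<bar>y\<bar> < \<delta> \<Longrightarrow> (D j has_real_derivative D (Suc j) y) (at y)"
    and even: "\<And>y. \<bar>y\<bar> < \<delta> \<Longrightarrow> D 0 (- y) = D 0 y"
  shows "j \<le> k \<Longrightarrow> \<bar>y\<bar> < \<delta> \<Longrightarrow> D j (- y) = (- 1) ^ j * D j y"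
proof (induction j arbitrary: y)
  case 0
  then show ?case
    using even by simp
next
  case (Suc j)
  have "(D j has_real_derivative D (Suc j) (- y)) (at (- y))"
    using der[of j "- y"] Suc.prems by simp
  then have "((\<lambda>t. D j (- t)) has_real_derivative D (Suc j) (- y) * - 1) (at y)"
    by (rule DERIV_chain2) (auto intro!: derivative_eq_intros)
  from DERIV_cmult[OF this, of "(- 1) ^ j"]
  have "((\<lambda>t. (- 1) ^ j * D j (- t)) has_real_derivative (- 1) ^ Suc j * D (Suc j) (- y)) (at y)"
    by simp
  then have "(D j has_real_derivative (- 1) ^ Suc j * D (Suc j) (- y)) (at y)"
  proof (rule has_field_derivative_transform_within_open[of _ _ _ "{-\<delta><..<\<delta>}"])
    show "(- 1) ^ j * D j (- t) = D j t" if "t \<in> {-\<delta><..<\<delta>}" for t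
      using Suc.IH[of t] Suc.prems that by (auto simp: abs_less_iff simp flip: mult.assoc power_add)
  qed (use Suc.prems in \<open>auto simp: abs_less_iff\<close>)
  then have "(- 1) ^ Suc j * D (Suc j) (- y) = D (Suc j) y"
    using der[of j y] Suc.prems DERIV_unique by fastforce
  then show ?case
    by (cases "even j") auto
qed

text \<open>All Maclaurin coefficients below order \<open>n\<close> vanish except the linear one, so
  only the remainder survives.\<close>

lemma Maclaurin_linear_bound:
  fixes E :: "nat \<Rightarrow> real \<Rightarrow> real"
  assumes "0 < \<delta>" "2 \<le> n"
    and der: "\<And>j y. j < n \<Longrightarrow> \<bar>y\<bar> < \<delta> \<Longrightarrow> (E j has_real_derivative E (Suc j) y) (at y)"
    and cont: "continuous_on {-\<delta><..<\<delta>} (E n)"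
    and zero: "\<And>j. j < n \<Longrightarrow> j \<noteq> 1 \<Longrightarrow> E j 0 = 0"
  obtains C where "0 < C" "\<And>y. 0 < y \<Longrightarrow> y < \<delta> / 2 \<Longrightarrow> \<bar>E 0 y - E 1 0 * y\<bar> \<le> C * y ^ n"
proof -
  \<comment> \<open>\<open>E n\<close> is continuous on the open interval only and may blow up at
    its ends; halving the radius makes it bounded.\<close>
  have "compact (E n ` {0..\<delta> / 2})"
    using \<open>0 < \<delta>\<close> by (intro compact_continuous_image continuous_on_subset[OF cont]) auto
  then obtain B where "B > 0" and B: "\<And>t. t \<in> {0..\<delta> / 2} \<Longrightarrow> \<bar>E n t\<bar> \<le> B"
    using compact_imp_bounded bounded_pos by (metis image_eqI real_norm_def)
  show thesis
  proof (rule that[OF \<open>B > 0\<close>])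
    fix y assume y: "0 < y" "y < \<delta> / 2"
    have "\<exists>t>0. t < y \<and> E 0 y = (\<Sum>j<n. E j 0 / fact j * y ^ j) + E n t / fact n * y ^ n"
      by (rule Maclaurin) (use y \<open>2 \<le> n\<close> der in auto)
    then obtain t where t: "0 < t" "t < y"
      "E 0 y = (\<Sum>j<n. E j 0 / fact j * y ^ j) + E n t / fact n * y ^ n"
      by blast
    have "(\<Sum>j<n. E j 0 / fact j * y ^ j) = (\<Sum>j\<in>{1}. E j 0 / fact j * y ^ j)"
      using \<open>2 \<le> n\<close> zero by (intro sum.mono_neutral_right) auto
    then have "\<bar>E 0 y - E 1 0 * y\<bar> = \<bar>E n t\<bar> / fact n * y ^ n"
      using t y by (simp add: abs_mult)
    also have "\<bar>E n t\<bar> / fact n \<le> B / 1"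
      using B[of t] t y \<open>B > 0\<close> by (intro frac_le) auto
    finally show "\<bar>E 0 y - E 1 0 * y\<bar> \<le> B * y ^ n"
      using y by (simp add: mult_right_mono)
  qed
qed

subsection \<open>Normal and principal curvatures along the profile\<close>

lemma rot_z_nth:
  "rot_z \<alpha> x $ 1 = cos \<alpha> * x$1 - sin \<alpha> * x$2"
  "rot_z \<alpha> x $ 2 = sin \<alpha> * x$1 + cos \<alpha> * x$2"
  "rot_z \<alpha> x $ 3 = x$3"
  by (simp_all add: rot_z_def)

lemma bounded_linear_rot_z: "bounded_linear (rot_z \<alpha>)"
  by (rule linear_conv_bounded_linear[THEN iffD1], rule linearI)
    (simp_all add: vec_eq_iff forall_3 rot_z_nth algebra_simps)

lemma rot_z_rot_z: "rot_z \<alpha> (rot_z \<beta> x) = rot_z (\<alpha> + \<beta>) x"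
  by (simp add: vec_eq_iff forall_3 rot_z_nth cos_add sin_add algebra_simps)

lemma rot_z_0: "rot_z 0 x = x"
  by (simp add: vec_eq_iff forall_3 rot_z_nth)

lemma inner_rot_z: "rot_z \<alpha> x \<bullet> y = x \<bullet> rot_z (- \<alpha>) y"
  by (simp add: inner_vec_def sum_3 rot_z_nth algebra_simps)

lemma norm_rot_z: "norm (rot_z \<alpha> x) = norm x"
  by (simp add: norm_eq_sqrt_inner inner_rot_z rot_z_rot_z rot_z_0)

lemma rot_z_z_axis: "x \<in> z_axis \<Longrightarrow> rot_z \<alpha> x = x"
  by (simp add: z_axis_def vec_eq_iff forall_3 rot_z_nth)

lemma dist_rot_z:
  assumes "p \<in> z_axis"
  shows "dist p (rot_z \<alpha> x) = dist p x"
proof -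
  have "p - rot_z \<alpha> x = rot_z \<alpha> (p - x)"
    using bounded_linear.linear[OF bounded_linear_rot_z] rot_z_z_axis[OF assms] by (simp add: linear_diff)
  then show ?thesis
    by (simp add: dist_norm norm_rot_z)
qed

lemma has_vector_derivative_rot_z:
  "((\<lambda>t. rot_z t x) has_vector_derivative vector [- x$2, x$1, 0]) (at 0)"
proof -
  have rot: "rot_z t x = (cos t * x$1 - sin t * x$2) *\<^sub>R axis 1 1 + (sin t * x$1 + cos t * x$2) *\<^sub>R axis 2 1
      + x$3 *\<^sub>R axis 3 1" for t
    by (simp add: vec_eq_iff forall_3 rot_z_nth axis_def)
  have vec: "(vector [- x$2, x$1, 0] :: real^3) = (- x$2) *\<^sub>R axis 1 1 + x$1 *\<^sub>R axis 2 1"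
    by (simp add: vec_eq_iff forall_3 axis_def)
  show ?thesis
    unfolding rot vec by (auto intro!: derivative_eq_intros simp: has_vector_derivative_def algebra_simps)
qed

lemma unit_normal_curve:
  assumes "unit_normal_field S N" "\<gamma> 0 \<in> S" "\<forall>\<^sub>F t in nhds 0. \<gamma> t \<in> S" "(\<gamma> has_vector_derivative v) (at 0)"
  shows "N (\<gamma> 0) \<bullet> v = 0"
  using assms unfolding unit_normal_field_def tangent_space_def by blast

text \<open>\<open>\<delta>\<close> bounds the parameter of the profile and \<open>\<eta>\<close> is
  the radius of a ball about \<open>p\<close>, invariant under rotation since \<open>p\<close> lies
  on the axis. Inside that ball the points of \<open>S\<close> in the yz-plane lie on the graph, and
  \<open>positive\<close> selects one of the two unit normals.\<close>

locale axial_profile =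
  fixes S :: "(real^3) set" and N :: "real^3 \<Rightarrow> real^3" and a p :: "real^3"
    and \<delta> \<eta> :: real and g g' g'' :: "real \<Rightarrow> real"
  assumes rot: "rot_z \<alpha> ` S = S" and normal: "unit_normal_field S N" and a: "axis_orientation a"
    and p: "p \<in> S" "p \<in> z_axis" "N p = a" and \<delta>: "0 < \<delta>" and \<eta>: "0 < \<eta>"
    and graph: "\<And>y. \<bar>y\<bar> < \<delta> \<Longrightarrow> profile_point a y (g y) \<in> S \<inter> ball p \<eta>"
    and graph_unique: "\<And>y z. profile_point a y z \<in> S \<inter> ball p \<eta> \<Longrightarrow> z = g y"
    and g': "\<And>y. \<bar>y\<bar> < \<delta> \<Longrightarrow> (g has_real_derivative g' y) (at y)"
    and g'': "\<And>y. \<bar>y\<bar> < \<delta> \<Longrightarrow> (g' has_real_derivative g'' y) (at y)"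
    and positive: "\<And>x. x \<in> S \<inter> ball p \<eta> \<Longrightarrow> N x \<bullet> a > 0"
begin

definition q :: "real \<Rightarrow> real^3" where "q y = profile_point a y (g y)"

text \<open>The cosine of the Gauss angle, that is the component of the normal along
  \<open>a\<close>.\<close>

definition \<nu> :: "real \<Rightarrow> real" where "\<nu> y = 1 / sqrt (1 + (g' y)\<^sup>2)"

text \<open>\<open>m\<close> is the sine of the signed Gauss angle. Hence \<open>k\<^sub>1 = m y / y\<close> and \<open>k\<^sub>2 = m' y\<close>, and the
  umbilic slope can be studied in the variable \<open>y\<close> instead of \<open>\<theta>\<close>.\<close>

definition m :: "real \<Rightarrow> real" where "m y = - g' y * \<nu> y"

text \<open>The signed curvature -g'' / (1 + g'^2)^(3/2) of the profile; it is also the derivative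
  of \<open>m\<close>.\<close>

definition m' :: "real \<Rightarrow> real" where "m' y = - g'' y * \<nu> y ^ 3"

definition n :: "real \<Rightarrow> real^3" where "n y = profile_point a (m y) (\<nu> y)"

lemma a3: "a$3 * a$3 = 1"
  by (rule axis_orientation_nth(3)[OF a])

lemma rot_mem: "x \<in> S \<Longrightarrow> rot_z \<alpha> x \<in> S"
  using rot by blast

lemma rot_ball: "x \<in> ball p \<eta> \<Longrightarrow> rot_z \<alpha> x \<in> ball p \<eta>"
  by (simp add: dist_rot_z p(2))

lemma q_mem: "\<bar>y\<bar> < \<delta> \<Longrightarrow> q y \<in> S" "\<bar>y\<bar> < \<delta> \<Longrightarrow> q y \<in> ball p \<eta>"
  using graph by (auto simp: q_def)

lemma q_nth: "q y $ 1 = 0" "q y $ 2 = y" "q y $ 3 = g y * a$3"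
  by (simp_all add: q_def profile_point_nth[OF a])

lemma n_nth: "n y $ 1 = 0" "n y $ 2 = m y" "n y $ 3 = \<nu> y * a$3"
  by (simp_all add: n_def profile_point_nth[OF a])

lemma q_0: "q 0 = p"
proof -
  have "p = profile_point a 0 (p \<bullet> a)"
    using eq_profile_pointI[OF a] p(2) by (simp add: z_axis_def)
  then show ?thesis
    using graph_unique[of 0 "p \<bullet> a"] p(1) \<eta> by (simp add: q_def)
qed

lemma \<nu>_pos: "\<nu> y > 0"
  by (simp add: \<nu>_def add_pos_nonneg)

lemma \<nu>_square: "(\<nu> y)\<^sup>2 * (1 + (g' y)\<^sup>2) = 1"
proof -
  have "1 + (g' y)\<^sup>2 > 0"
    by (simp add: add_pos_nonneg)
  then show ?thesis
    by (simp add: \<nu>_def power_divide)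
qed

lemma m_\<nu>: "(m y)\<^sup>2 + (\<nu> y)\<^sup>2 = 1"
  using \<nu>_square[of y] by (simp add: m_def power_mult_distrib algebra_simps)

lemma has_derivative_\<nu>:
  assumes "\<bar>y\<bar> < \<delta>"
  shows "(\<nu> has_real_derivative - (g' y * g'' y * \<nu> y ^ 3)) (at y)"
proof -
  have pos: "1 + (g' y)\<^sup>2 > 0"
    by (simp add: add_pos_nonneg)
  define s where "s = sqrt (1 + (g' y)\<^sup>2)"
  have "s \<noteq> 0"
    using pos by (simp add: s_def)
  have "(\<nu> has_real_derivative - ((g' y * g'' y * 2) * inverse s / 2) / s\<^sup>2) (at y)"
    unfolding \<nu>_def[abs_def] s_def using g''[OF assms] pos
    by (auto intro!: derivative_eq_intros simp: power2_eq_square)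
  also have "- ((g' y * g'' y * 2) * inverse s / 2) / s\<^sup>2 = - (g' y * g'' y * (1 / s) ^ 3)"
    using \<open>s \<noteq> 0\<close> by (simp add: field_simps power2_eq_square power3_eq_cube)
  finally show ?thesis
    by (simp add: \<nu>_def[of y] s_def)
qed

lemma has_derivative_m:
  assumes "\<bar>y\<bar> < \<delta>"
  shows "(m has_real_derivative m' y) (at y)"
proof -
  have "(m has_real_derivative - g'' y * \<nu> y + (- g' y) * - (g' y * g'' y * \<nu> y ^ 3)) (at y)"
    unfolding m_def[abs_def]
    by (rule derivative_eq_intros has_derivative_\<nu>[OF assms] g''[OF assms] refl)+ simp
  also have "- g'' y * \<nu> y + (- g' y) * - (g' y * g'' y * \<nu> y ^ 3) = m' y"
    unfolding m'_def using \<nu>_square[of y] by algebra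
  finally show ?thesis .
qed

lemma has_derivative_q:
  assumes "\<bar>y\<bar> < \<delta>"
  shows "((\<lambda>t. q (y + t)) has_vector_derivative profile_point a 1 (g' y)) (at 0)"
proof -
  have "((\<lambda>t. g (y + t)) has_real_derivative g' y) (at 0)"
    using g'[OF assms] DERIV_at_within_shift[of g "g' y" y 0 UNIV] by (simp add: add.commute)
  then show ?thesis
    unfolding q_def profile_point_def
    by (auto intro!: derivative_eq_intros)
qed

text \<open>Rodrigues' formula for a plane curve: the normal moves along the tangent at a rate given
  by the curvature. The height component comes out right because the derivative of
  \<open>\<nu>\<close> is \<open>m' y * g' y\<close>.\<close>

lemma has_derivative_n:
  assumes "\<bar>y\<bar> < \<delta>"
  shows "((\<lambda>t. n (y + t)) has_vector_derivative m' y *\<^sub>R profile_point a 1 (g' y)) (at 0)"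
proof -
  have "((\<lambda>t. m (y + t)) has_real_derivative m' y) (at 0)"
    using has_derivative_m[OF assms] DERIV_at_within_shift[of m "m' y" y 0 UNIV] by (simp add: add.commute)
  moreover have "((\<lambda>t. \<nu> (y + t)) has_real_derivative m' y * g' y) (at 0)"
    using has_derivative_\<nu>[OF assms] DERIV_at_within_shift[of \<nu> _ y 0 UNIV]
    by (simp add: add.commute m'_def mult_ac)
  ultimately show ?thesis
    unfolding n_def profile_point_def
    by (auto intro!: derivative_eq_intros simp: algebra_simps)
qed

lemma near:
  assumes "\<bar>y\<bar> < \<delta>"
  shows "\<forall>\<^sub>F t in nhds 0. \<bar>y + t\<bar> < \<delta>"
proof -
  have "((\<lambda>t. \<bar>y + t\<bar>) \<longlongrightarrow> \<bar>y + 0\<bar>) (nhds 0)"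
    by (intro tendsto_intros filterlim_ident)
  then show ?thesis
    using assms order_tendstoD(2) by fastforce
qed

text \<open>Rotated back to the yz-plane, the normal is orthogonal to the meridian and to the
  parallel, has length 1 and a positive component along \<open>a\<close>. These conditions determine
  it off the axis.\<close>

lemma normal_profile:
  assumes "\<bar>y\<bar> < \<delta>"
  shows "N (rot_z \<alpha> (q y)) = rot_z \<alpha> (n y)"
proof -
  define M where "M = rot_z (- \<alpha>) (N (rot_z \<alpha> (q y)))"
  have mem: "rot_z \<alpha> (q y) \<in> S \<inter> ball p \<eta>"
    using rot_mem rot_ball q_mem[OF assms] by simp
  have meridian: "M \<bullet> profile_point a 1 (g' y) = 0"
  proof -
    have "((\<lambda>t. rot_z \<alpha> (q (y + t))) has_vector_derivative rot_z \<alpha> (profile_point a 1 (g' y))) (at 0)"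
      by (rule bounded_linear.has_vector_derivative[OF bounded_linear_rot_z has_derivative_q[OF assms]])
    moreover have "\<forall>\<^sub>F t in nhds 0. rot_z \<alpha> (q (y + t)) \<in> S"
      using near[OF assms] by eventually_elim (simp add: rot_mem q_mem)
    ultimately have "N (rot_z \<alpha> (q (y + 0))) \<bullet> rot_z \<alpha> (profile_point a 1 (g' y)) = 0"
      using unit_normal_curve[OF normal, of "\<lambda>t. rot_z \<alpha> (q (y + t))"] mem by simp
    then show ?thesis
      by (simp add: M_def inner_rot_z)
  qed
  have M_a: "M \<bullet> a > 0"
    using positive[OF mem] rot_z_z_axis[of a \<alpha>] axis_orientation_nth[OF a]
    by (simp add: M_def inner_rot_z z_axis_def)
  have M_norm: "norm M = 1"
    using normal mem by (simp add: M_def norm_rot_z unit_normal_field_def)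
  have M1: "M$1 = 0"
  \<comment> \<open>On the axis the parallel has velocity zero and gives no condition; there
    \<open>N p = a\<close> is used directly.\<close>
  proof (cases "y = 0")
    case True
    then show ?thesis
      using axis_orientation_nth[OF a] p rot_z_z_axis[of p \<alpha>]
      by (simp add: M_def q_0 rot_z_nth)
  next
    case False
    have "((\<lambda>t. rot_z \<alpha> (rot_z t (q y))) has_vector_derivative rot_z \<alpha> (vector [- y, 0, 0])) (at 0)"
      using bounded_linear.has_vector_derivative[OF bounded_linear_rot_z has_vector_derivative_rot_z[of "q y"]]
      by (simp add: q_nth)
    then have "N (rot_z \<alpha> (rot_z 0 (q y))) \<bullet> rot_z \<alpha> (vector [- y, 0, 0]) = 0"
      using unit_normal_curve[OF normal, of "\<lambda>t. rot_z \<alpha> (rot_z t (q y))"] q_mem(1)[OF assms]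
      by (simp add: rot_mem)
    then have "M \<bullet> vector [- y, 0, 0] = 0"
      by (simp add: M_def inner_rot_z rot_z_0)
    then show ?thesis
      using False by (simp add: inner_vec_def sum_3)
  qed
  define u where "u = M$3 * a$3"
  have M3: "M$3 = u * a$3"
    using a3 by (simp add: u_def mult.assoc)
  have M2: "M$2 = - g' y * u"
    using meridian by (simp add: inner_vec_def sum_3 profile_point_nth[OF a] M1 u_def mult_ac)
  have "(M$2)\<^sup>2 + (M$3)\<^sup>2 = 1"
    using M_norm M1 by (simp add: norm_eq_sqrt_inner inner_vec_def sum_3 power2_eq_square)
  then have "u\<^sup>2 * (1 + (g' y)\<^sup>2) = 1"
    unfolding M2 M3 using a3 by algebra
  then have "u\<^sup>2 = (\<nu> y)\<^sup>2"
    using \<nu>_square[of y] by algebra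
  moreover have "u > 0"
    using M_a by (simp add: u_def inner_axis_orientation[OF a])
  ultimately have "u = \<nu> y"
    using \<nu>_pos[of y] by (simp add: power2_eq_iff_nonneg)
  then have "M = n y"
    by (simp add: vec_eq_iff forall_3 n_nth M1 M2 M3 m_def)
  then have "rot_z \<alpha> M = rot_z \<alpha> (n y)"
    by simp
  then show ?thesis
    by (simp add: M_def rot_z_rot_z rot_z_0)
qed

lemma normal_q: "\<bar>y\<bar> < \<delta> \<Longrightarrow> N (q y) = n y"
  using normal_profile[of y 0] by (simp add: rot_z_0)

text \<open>The half turn about the axis maps the graph point over \<open>y\<close> to a point of
  \<open>S\<close> over \<open>- y\<close> at the same height, inside the same ball.\<close>

lemma g_even: "\<bar>y\<bar> < \<delta> \<Longrightarrow> g (- y) = g y"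
proof -
  assume y: "\<bar>y\<bar> < \<delta>"
  have "rot_z pi (q y) = profile_point a (- y) (g y)"
    by (simp add: vec_eq_iff forall_3 rot_z_nth q_nth profile_point_nth[OF a])
  then show ?thesis
    using graph_unique[of "- y" "g y"] rot_mem[OF q_mem(1)[OF y], of pi] rot_ball[OF q_mem(2)[OF y], of pi]
    by simp
qed

end

text \<open>Continuity of \<open>f\<close> is enough because \<open>l\<close> vanishes at
  \<open>x\<close>: the error \<open>(f y - f x) * l y\<close> is a null factor times O(|y - x|).
  This handles the horizontal components of \<open>N\<close> at \<open>p\<close>.\<close>

lemma has_derivative_mult_vanishing:
  fixes f :: "'a::real_normed_vector \<Rightarrow> real"
  assumes "isCont f x" "bounded_linear l" "l x = 0"
  shows "((\<lambda>y. f y * l y) has_derivative (\<lambda>h. f x * l h)) (at x)"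
proof -
  obtain K where K: "\<And>h. \<bar>l h\<bar> \<le> norm h * K"
    using bounded_linear.bounded[OF assms(2)] by (auto simp del: real_norm_def simp flip: real_norm_def)
  have "((\<lambda>y. \<bar>f y - f x\<bar> * K) \<longlongrightarrow> \<bar>f x - f x\<bar> * K) (at x)"
    using assms(1) unfolding isCont_def by (intro tendsto_intros)
  then have lim: "((\<lambda>y. \<bar>f y - f x\<bar> * K) \<longlongrightarrow> 0) (at x)"
    by simp
  have bound: "norm (f y * l y - f x * l x - f x * l (y - x)) / norm (y - x) \<le> \<bar>f y - f x\<bar> * K" for y
  proof (cases "y = x")
    case False
    have "l (y - x) = l y"
      using assms(3) linear_diff[OF bounded_linear.linear[OF assms(2)]] by simp
    then have "norm (f y * l y - f x * l x - f x * l (y - x)) = \<bar>f y - f x\<bar> * \<bar>l (y - x)\<bar>"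
      using assms(3) by (simp add: abs_mult algebra_simps flip: abs_mult)
    also have "\<dots> \<le> \<bar>f y - f x\<bar> * (norm (y - x) * K)"
      using K by (intro mult_left_mono) auto
    finally show ?thesis
      using False by (simp add: divide_le_eq mult_ac)
  next
    case True
    then show ?thesis
      by simp
  qed
  show ?thesis
    unfolding has_derivative_iff_norm
  proof
    show "bounded_linear (\<lambda>h. f x * l h)"
      by (rule bounded_linear_const_mult[OF assms(2)])
    show "((\<lambda>y. norm (f y * l y - f x * l x - f x * l (y - x)) / norm (y - x)) \<longlongrightarrow> 0) (at x)"
      by (rule Lim_null_comparison[OF _ lim]) (use bound in \<open>auto intro!: always_eventually\<close>)
  qed
qed

text \<open>The derivative within \<open>S\<close> may be ambiguous off the tangent plane, but on
  the velocity of a curve in \<open>S\<close> the chain rule fixes its value. Every curvature below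
  is computed from a suitable curve.\<close>

lemma shape_operator_curve:
  assumes "N differentiable (at (\<gamma> 0) within S)" "\<gamma> 0 \<in> S" "\<forall>\<^sub>F t in nhds 0. \<gamma> t \<in> S"
    and "(\<gamma> has_vector_derivative v) (at 0)" "((\<lambda>t. N (\<gamma> t)) has_vector_derivative w) (at 0)"
  shows "shape_operator S N (\<gamma> 0) v = w"
proof -
  define D where "D = frechet_derivative N (at (\<gamma> 0) within S)"
  have D: "(N has_derivative D) (at (\<gamma> 0) within S)"
    using assms(1) by (simp add: D_def frechet_derivative_works)
  obtain T where T: "open T" "0 \<in> T" "\<And>t. t \<in> T \<Longrightarrow> \<gamma> t \<in> S"
    using assms(3) unfolding eventually_nhds by auto
  have "(\<gamma> has_vector_derivative v) (at 0 within T)"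
    using assms(4) has_vector_derivative_at_within by blast
  moreover have "(N has_derivative D) (at (\<gamma> 0) within \<gamma> ` T)"
    by (rule has_derivative_subset[OF D]) (use T(3) in auto)
  ultimately have "(N \<circ> \<gamma> has_vector_derivative D v) (at 0 within T)"
    by (rule vector_derivative_diff_chain_within)
  then have "((\<lambda>t. N (\<gamma> t)) has_vector_derivative D v) (at 0)"
    using at_within_open[OF T(2,1)] by (simp add: o_def)
  then show ?thesis
    using vector_derivative_unique_at[OF _ assms(5)] by (simp add: shape_operator_def D_def)
qed

lemma principal_curvature_eqI:
  assumes "shape_operator S N x v = \<kappa> *\<^sub>R v" "v \<noteq> 0"
  shows "principal_curvature S N x v = \<kappa>"
  unfolding principal_curvature_def using assms by (intro the_equality) auto

section \<open>Differentiability of the Gauss map and the principal curvatures on the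
  profile\<close>

context axial_profile
begin

definition r :: "real^3 \<Rightarrow> real" where "r x = sqrt ((x$1)\<^sup>2 + (x$2)\<^sup>2)"

text \<open>The curvature along parallels as a function of the distance from the axis; the value at
  \<open>0\<close> is its limit there.\<close>

definition \<kappa> :: "real \<Rightarrow> real" where "\<kappa> y = (if y = 0 then m' 0 else m y / y)"

lemma m_0: "m 0 = 0"
proof -
  have "n 0 = a"
    using normal_q[of 0] \<delta> p(3) by (simp add: q_0)
  then show ?thesis
    using n_nth(2)[of 0] axis_orientation_nth(2)[OF a] by simp
qed

lemma g'_0: "g' 0 = 0"
  using m_0 \<nu>_pos[of 0] by (simp add: m_def)

text \<open>Polar coordinates with the angle measured from the y-axis, which explains the sign of
  \<open>sin\<close>. Rotating \<open>x\<close> back into the yz-plane lands on the graph by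
  uniqueness.\<close>

lemma polar:
  assumes "x \<in> S \<inter> ball p \<eta>"
  obtains \<alpha> where "x$1 = - sin \<alpha> * r x" "x$2 = cos \<alpha> * r x" "x = rot_z \<alpha> (q (r x))"
proof -
  obtain \<alpha> where \<alpha>: "x$1 = - sin \<alpha> * r x" "x$2 = cos \<alpha> * r x"
  proof (cases "r x = 0")
    case True
    then show ?thesis
      using that[of 0] by (simp add: r_def sum_power2_eq_zero_iff)
  next
    case False
    have sq: "(x$2)\<^sup>2 + (x$1)\<^sup>2 = (r x)\<^sup>2"
      by (simp add: r_def)
    have "(x$2 / r x)\<^sup>2 + (- x$1 / r x)\<^sup>2 = (r x)\<^sup>2 / (r x)\<^sup>2"
      unfolding power_divide power2_minus add_divide_distrib[symmetric] sq ..
    then have "(x$2 / r x)\<^sup>2 + (- x$1 / r x)\<^sup>2 = 1"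
      using False by simp
    then obtain \<alpha> where "x$2 / r x = cos \<alpha>" "- x$1 / r x = sin \<alpha>"
      using sincos_total_2pi by metis
    then show ?thesis
      using False that[of \<alpha>] by (simp add: field_simps)
  qed
  define x' where "x' = rot_z (- \<alpha>) x"
  have "x'$1 = 0"
    by (simp add: x'_def rot_z_nth \<alpha>)
  moreover have "x'$2 = r x * ((sin \<alpha>)\<^sup>2 + (cos \<alpha>)\<^sup>2)"
    unfolding x'_def rot_z_nth \<alpha> cos_minus sin_minus by algebra
  then have "x'$2 = r x"
    by simp
  ultimately have "x' = profile_point a (r x) (x' \<bullet> a)"
    using eq_profile_pointI[OF a] by blast
  moreover have "x' \<in> S \<inter> ball p \<eta>"
    using assms rot_mem rot_ball by (simp add: x'_def)
  ultimately have "x' = q (r x)"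
    using graph_unique unfolding q_def by metis
  moreover have "x = rot_z \<alpha> x'"
    by (simp add: x'_def rot_z_rot_z rot_z_0)
  ultimately show thesis
    using that \<alpha> by blast
qed

text \<open>Rotational symmetry makes the horizontal part of the normal
  \<open>\<kappa> (r x)\<close> times that of \<open>x\<close>, and the unit length gives the rest.
  The right-hand side makes sense on an open set of the ambient space, where its differentiability
  can be tested.\<close>

lemma normal_formula:
  assumes "x \<in> S \<inter> ball p \<eta>" "r x < \<delta>"
  shows "N x = (\<kappa> (r x) * x$1) *\<^sub>R axis 1 1 + (\<kappa> (r x) * x$2) *\<^sub>R axis 2 1
    + sqrt (1 - (\<kappa> (r x) * x$1)\<^sup>2 - (\<kappa> (r x) * x$2)\<^sup>2) *\<^sub>R a"
proof -
  obtain \<alpha> where \<alpha>: "x$1 = - sin \<alpha> * r x" "x$2 = cos \<alpha> * r x" "x = rot_z \<alpha> (q (r x))"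
    using polar[OF assms(1)] .
  have "r x \<ge> 0"
    by (simp add: r_def)
  then have N: "N x = rot_z \<alpha> (n (r x))"
    using normal_profile[of "r x" \<alpha>] \<alpha>(3) assms(2) by simp
  have \<kappa>: "\<kappa> (r x) * r x = m (r x)"
    by (simp add: \<kappa>_def m_0)
  have 1: "\<kappa> (r x) * x$1 = - sin \<alpha> * m (r x)" and 2: "\<kappa> (r x) * x$2 = cos \<alpha> * m (r x)"
    using \<kappa> by (simp_all add: \<alpha>(1,2) mult_ac flip: \<kappa>)
  have "1 - (- sin \<alpha> * m (r x))\<^sup>2 - (cos \<alpha> * m (r x))\<^sup>2 = (\<nu> (r x))\<^sup>2"
    using m_\<nu>[of "r x"] sin_cos_squared_add[of \<alpha>] by algebra
  then have "sqrt (1 - (- sin \<alpha> * m (r x))\<^sup>2 - (cos \<alpha> * m (r x))\<^sup>2) = \<nu> (r x)"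
    using \<nu>_pos[of "r x"] by simp
  then show ?thesis
    unfolding 1 2 N using axis_orientation_nth[OF a]
    by (simp add: vec_eq_iff forall_3 rot_z_nth n_nth axis_def)
qed

text \<open>Away from the axis this is the chain rule. At \<open>p\<close> the function
  \<open>r\<close> is not differentiable, but \<open>\<kappa> (r x)\<close> is continuous and the
  coordinate vanishes.\<close>

lemma differentiable_\<kappa>:
  assumes "\<bar>y\<bar> < \<delta>" "i \<in> {1, 2}"
  shows "(\<lambda>x. \<kappa> (r x) * x $ i) differentiable (at (q y))"
proof (cases "y = 0")
  case True
  have "((\<lambda>t. m t / t) \<longlongrightarrow> m' 0) (at 0)"
    using has_derivative_m[of 0] \<delta> by (simp add: has_field_derivative_iff m_0)
  then have "(\<kappa> \<longlongrightarrow> m' 0) (at 0)"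
    by (simp add: Lim_transform_eventually \<kappa>_def[abs_def] eventually_at_filter)
  then have "isCont \<kappa> 0"
    by (simp add: isCont_def \<kappa>_def)
  moreover have "isCont r p"
    unfolding r_def[abs_def] by (intro continuous_intros)
  moreover have "r p = 0"
    using p(2) by (simp add: r_def z_axis_def)
  ultimately have cont: "isCont (\<lambda>x. \<kappa> (r x)) p"
    using isCont_o2[of p r \<kappa>] by simp
  have "p $ i = 0"
    using p(2) assms(2) by (auto simp: z_axis_def)
  then show ?thesis
    unfolding True q_0
    by (rule differentiableI[OF has_derivative_mult_vanishing[OF cont bounded_linear_vec_nth]])
next
  case False
  have "r (q y) = \<bar>y\<bar>"
    by (simp add: r_def q_nth)
  have "((\<lambda>t. m t / t) has_real_derivative (m' \<bar>y\<bar> * \<bar>y\<bar> - m \<bar>y\<bar>) / (\<bar>y\<bar> * \<bar>y\<bar>)) (at \<bar>y\<bar>)"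
    using False assms(1) by (auto intro!: derivative_eq_intros has_derivative_m)
  then have "(\<kappa> has_real_derivative (m' \<bar>y\<bar> * \<bar>y\<bar> - m \<bar>y\<bar>) / (\<bar>y\<bar> * \<bar>y\<bar>)) (at \<bar>y\<bar>)"
    by (rule has_field_derivative_transform_within_open[of _ _ _ "- {0}"]) (use False in \<open>auto simp: \<kappa>_def\<close>)
  then have "\<kappa> differentiable (at (r (q y)))"
    unfolding \<open>r (q y) = \<bar>y\<bar>\<close> by (rule differentiableI[OF has_field_derivative_imp_has_derivative])
  moreover have "((\<lambda>x. (x$1)\<^sup>2 + (x$2)\<^sup>2) has_derivative (\<lambda>h. 2 * (q y $ 1 * h$1) + 2 * (q y $ 2 * h$2))) (at (q y))"
    by (auto intro!: derivative_eq_intros bounded_linear.has_derivative[OF bounded_linear_vec_nth])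
  then have "(r has_derivative (\<lambda>h. (2 * (q y $ 1 * h$1) + 2 * (q y $ 2 * h$2)) * (inverse (sqrt ((q y $ 1)\<^sup>2 + (q y $ 2)\<^sup>2)) / 2))) (at (q y))"
    unfolding r_def[abs_def] by (rule has_derivative_real_sqrt[rotated]) (use False in \<open>simp add: q_nth\<close>)
  then have "r differentiable (at (q y))"
    by (rule differentiableI)
  ultimately have "(\<lambda>x. \<kappa> (r x)) differentiable (at (q y))"
    by (rule differentiable_compose)
  moreover have "(\<lambda>x. x $ i) differentiable (at (q y))"
    by (rule differentiableI[OF bounded_linear_imp_has_derivative[OF bounded_linear_vec_nth]])
  ultimately show ?thesis
    by (rule differentiable_mult)
qed

lemma differentiable_N:
  assumes "\<bar>y\<bar> < \<delta>"
  shows "N differentiable (at (q y) within S)"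
proof -
  define A where "A x = \<kappa> (r x) * x$1" for x :: "real^3"
  define B where "B x = \<kappa> (r x) * x$2" for x :: "real^3"
  have AB: "A differentiable (at (q y))" "B differentiable (at (q y))"
    unfolding A_def[abs_def] B_def[abs_def] using differentiable_\<kappa>[OF assms] by simp_all
  have "r (q y) = \<bar>y\<bar>"
    by (simp add: r_def q_nth)
  \<comment> \<open>This keeps the radicand positive at \<open>q y\<close>, so the square root is
    differentiable there; \<open>B (q y)\<close> is \<open>m y\<close>, whose square is below 1
    since \<open>\<nu> y\<close> is positive.\<close>
  have "A (q y) = 0" "(B (q y))\<^sup>2 < 1"
  proof -
    show "A (q y) = 0"
      by (simp add: A_def q_nth)
    have "N (q y) $ 2 = B (q y)"
      using normal_formula[of "q y"] q_mem[OF assms] assms \<open>r (q y) = \<bar>y\<bar>\<close> axis_orientation_nth[OF a]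
      by (simp add: B_def axis_def)
    then show "(B (q y))\<^sup>2 < 1"
      using m_\<nu>[of y] \<nu>_pos[of y] by (simp add: normal_q[OF assms] n_nth) (smt (verit) zero_less_power)
  qed
  define F where "F x = A x *\<^sub>R axis 1 1 + B x *\<^sub>R axis 2 1 + sqrt (1 - (A x)\<^sup>2 - (B x)\<^sup>2) *\<^sub>R a" for x :: "real^3"
  obtain A' B' where A': "(A has_derivative A') (at (q y))" and B': "(B has_derivative B') (at (q y))"
    using AB unfolding differentiable_def by blast
  have "((\<lambda>x. 1 - (A x)\<^sup>2 - (B x)\<^sup>2) has_derivative (\<lambda>h. - (2 * (A (q y) * A' h)) - 2 * (B (q y) * B' h))) (at (q y))"
    by (auto intro!: derivative_eq_intros A' B')
  from has_derivative_real_sqrt[OF _ this] \<open>A (q y) = 0\<close> \<open>(B (q y))\<^sup>2 < 1\<close>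
  have "(\<lambda>x. sqrt (1 - (A x)\<^sup>2 - (B x)\<^sup>2)) differentiable (at (q y))"
    by (auto intro: differentiableI)
  then have "F differentiable (at (q y))"
    unfolding F_def[abs_def] using AB by (intro differentiable_add differentiable_scaleR differentiable_const) auto
  then obtain F' where "(F has_derivative F') (at (q y))"
    unfolding differentiable_def by blast
  then have F': "(F has_derivative F') (at (q y) within S)"
    by (rule has_derivative_at_withinI)
  define T where "T = ball p \<eta> \<inter> {x. r x < \<delta>}"
  have "open T"
    unfolding T_def r_def by (intro open_Int open_ball open_Collect_less continuous_intros)
  moreover have "q y \<in> T"
    using q_mem[OF assms] assms \<open>r (q y) = \<bar>y\<bar>\<close> by (simp add: T_def)
  ultimately obtain e where "e > 0" and e: "ball (q y) e \<subseteq> T"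
    using open_contains_ball by blast
  have "(N has_derivative F') (at (q y) within S)"
  proof (rule has_derivative_transform_within[OF F' \<open>e > 0\<close> q_mem(1)[OF assms]])
    fix x assume "x \<in> S" "dist x (q y) < e"
    then have "x \<in> T"
      using e by (auto simp: dist_commute)
    then show "F x = N x"
      using normal_formula[of x] \<open>x \<in> S\<close> by (simp add: T_def F_def A_def B_def)
  qed
  then show ?thesis
    by (rule differentiableI)
qed

lemma shape_meridian:
  assumes "\<bar>y\<bar> < \<delta>"
  shows "shape_operator S N (q y) (profile_point a 1 (g' y)) = m' y *\<^sub>R profile_point a 1 (g' y)"
proof -
  have "((\<lambda>t. N (q (y + t))) has_vector_derivative m' y *\<^sub>R profile_point a 1 (g' y)) (at 0)"
  proof (rule has_vector_derivative_transform_within_open[OF has_derivative_n[OF assms], where S = "{t. \<bar>y + t\<bar> < \<delta>}"])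
    show "open {t. \<bar>y + t\<bar> < \<delta>}"
      by (intro open_Collect_less continuous_intros)
  qed (use assms in \<open>auto simp: normal_q\<close>)
  moreover have "\<forall>\<^sub>F t in nhds 0. q (y + t) \<in> S"
    using near[OF assms] by eventually_elim (simp add: q_mem)
  ultimately show ?thesis
    using shape_operator_curve[of N "\<lambda>t. q (y + t)" S] differentiable_N[OF assms] has_derivative_q[OF assms] q_mem[OF assms]
    by simp
qed

text \<open>Along a parallel, point and normal rotate together, with velocities proportional to
  their distances \<open>y\<close> and \<open>m y\<close> from the axis.\<close>

lemma k1_q:
  assumes "\<bar>y\<bar> < \<delta>" "y \<noteq> 0"
  shows "k1 S N (q y) = m y / y"
proof -
  have dir: "parallel_direction (q y) = vector [- y, 0, 0]"
    using assms(2) by (simp add: parallel_direction_def z_axis_def q_nth)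
  have "((\<lambda>t. rot_z t (q y)) has_vector_derivative vector [- y, 0, 0]) (at 0)"
    using has_vector_derivative_rot_z[of "q y"] by (simp add: q_nth)
  moreover have "((\<lambda>t. N (rot_z t (q y))) has_vector_derivative vector [- m y, 0, 0]) (at 0)"
    using has_vector_derivative_rot_z[of "n y"] by (simp add: n_nth normal_profile[OF assms(1)])
  ultimately have "shape_operator S N (q y) (vector [- y, 0, 0]) = vector [- m y, 0, 0]"
    using shape_operator_curve[of N "\<lambda>t. rot_z t (q y)" S] differentiable_N[OF assms(1)] q_mem[OF assms(1)]
    by (simp add: rot_z_0 rot_mem)
  also have "(vector [- m y, 0, 0] :: real^3) = (m y / y) *\<^sub>R vector [- y, 0, 0]"
    using assms(2) by (simp add: vec_eq_iff forall_3)
  finally show ?thesis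
    unfolding k1_def dir
    by (rule principal_curvature_eqI) (use assms(2) in \<open>simp add: vec_eq_iff forall_3\<close>)
qed

lemma k2_q:
  assumes "\<bar>y\<bar> < \<delta>" "y \<noteq> 0"
  shows "k2 S N (q y) = m' y"
proof -
  \<comment> \<open>The factor in the cross product of \<open>n y\<close> with the parallel
    direction; \<open>a$3\<close> is the sign of the chosen axis orientation.\<close>
  define c where "c = - y * \<nu> y * a$3"
  have "parallel_direction (q y) = vector [- y, 0, 0]"
    using assms(2) by (simp add: parallel_direction_def z_axis_def q_nth)
  then have dir: "profile_direction N (q y) = c *\<^sub>R profile_point a 1 (g' y)"
    using a3 by (simp add: profile_direction_def normal_q[OF assms(1)] vec_eq_iff forall_3 cross3_def
        n_nth profile_point_nth[OF a] c_def m_def)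
  have "linear (shape_operator S N (q y))"
    unfolding shape_operator_def
    by (rule has_derivative_linear[OF frechet_derivative_works[THEN iffD1, OF differentiable_N[OF assms(1)]]])
  then have "shape_operator S N (q y) (c *\<^sub>R profile_point a 1 (g' y)) = m' y *\<^sub>R (c *\<^sub>R profile_point a 1 (g' y))"
    by (simp add: linear_scale shape_meridian[OF assms(1)])
  moreover have "c *\<^sub>R profile_point a 1 (g' y) \<noteq> 0"
  proof -
    have "c \<noteq> 0"
      using assms(2) \<nu>_pos[of y] a3 by (auto simp: c_def)
    moreover have "profile_point a 1 (g' y) \<noteq> 0"
      using profile_point_nth(2)[OF a, of 1 "g' y"] by (metis zero_index zero_neq_one)
    ultimately show ?thesis
      by simp
  qed
  ultimately show ?thesis
    unfolding k2_def dir by (rule principal_curvature_eqI)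
qed

text \<open>At \<open>p\<close> the parallel direction is \<open>axis 1 1\<close> by convention. The
  profile rotated by -pi/2 passes through \<open>p\<close> with that velocity, since
  \<open>g' 0 = 0\<close>, so the meridian computation applies.\<close>

lemma k1_p: "k1 S N p = m' 0"
proof -
  have e1: "rot_z (- (pi / 2)) (profile_point a 1 (g' 0)) = axis 1 1"
    using g'_0 by (simp add: vec_eq_iff forall_3 rot_z_nth profile_point_nth[OF a] axis_def)
  have \<delta>0: "\<bar>0\<bar> < \<delta>"
    using \<delta> by simp
  have "((\<lambda>t. rot_z (- (pi / 2)) (q (0 + t))) has_vector_derivative axis 1 1) (at 0)"
    using bounded_linear.has_vector_derivative[OF bounded_linear_rot_z has_derivative_q[OF \<delta>0], of "- (pi / 2)"] e1
    by simp
  moreover have "((\<lambda>t. rot_z (- (pi / 2)) (n (0 + t))) has_vector_derivative m' 0 *\<^sub>R axis 1 1) (at 0)"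
    using bounded_linear.has_vector_derivative[OF bounded_linear_rot_z has_derivative_n[OF \<delta>0], of "- (pi / 2)"] e1
      linear_scale[OF bounded_linear.linear[OF bounded_linear_rot_z]] by simp
  then have "((\<lambda>t. N (rot_z (- (pi / 2)) (q (0 + t)))) has_vector_derivative m' 0 *\<^sub>R axis 1 1) (at 0)"
  proof (rule has_vector_derivative_transform_within_open[where S = "{t. \<bar>0 + t\<bar> < \<delta>}"])
    show "open {t. \<bar>0 + t\<bar> < \<delta>}"
      by (intro open_Collect_less continuous_intros)
  qed (use \<delta> in \<open>auto simp: normal_profile\<close>)
  moreover have "\<forall>\<^sub>F t in nhds 0. rot_z (- (pi / 2)) (q (0 + t)) \<in> S"
    using near[OF \<delta>0] by eventually_elim (simp add: q_mem rot_mem)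
  moreover have "rot_z (- (pi / 2)) (q (0 + 0)) = p"
    using p(2) by (simp add: q_0 rot_z_z_axis)
  ultimately have "shape_operator S N p (axis 1 1) = m' 0 *\<^sub>R axis 1 1"
    using shape_operator_curve[of N "\<lambda>t. rot_z (- (pi / 2)) (q (0 + t))" S] differentiable_N[OF \<delta>0] p(1)
    by (simp add: q_0)
  then show ?thesis
    unfolding k1_def using p(2)
    by (intro principal_curvature_eqI) (simp_all add: parallel_direction_def axis_eq_0_iff)
qed

section \<open>From the slope of the profile to the sine of the Gauss angle, and from the angle to
  \<open>y\<close>\<close>

lemma isCont_m': "isCont g'' 0 \<Longrightarrow> isCont m' 0"
  unfolding m'_def[abs_def] using has_derivative_\<nu>[of 0] \<delta> by (intro continuous_intros) (auto dest: DERIV_isCont)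

lemma isCont_q: "isCont q 0"
  unfolding q_def[abs_def] profile_point_def using g'[of 0] \<delta> by (intro continuous_intros) (auto dest: DERIV_isCont)

text \<open>Since \<open>m + g' = g' * (1 - \<nu>)\<close> and 1 - \<open>\<nu>\<close> is at most
  g'^2, the functions \<open>m\<close> and \<open>- g'\<close> differ by a cubic term. Hence a bound
  for \<open>g'\<close> of order at most 3 passes to \<open>m\<close>.\<close>

lemma m_linear_bound:
  assumes "2 \<le> j" "j \<le> 3"
    and bound: "\<And>y. 0 < y \<Longrightarrow> y < d \<Longrightarrow> \<bar>g' y - g'' 0 * y\<bar> \<le> C * y ^ j"
  obtains K where "\<And>y. 0 < y \<Longrightarrow> y < min d 1 \<Longrightarrow> \<bar>m y - m' 0 * y\<bar> \<le> K * y ^ j"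
proof -
  \<comment> \<open>Chosen so that \<open>\<bar>g' y\<bar> \<le> L * y\<close>; the restriction
    \<open>y < 1\<close> allows y^j to be replaced by y here and y^3 by y^j below.\<close>
  define L where "L = \<bar>C\<bar> + \<bar>g'' 0\<bar>"
  have m'0: "m' 0 = - g'' 0"
    by (simp add: m'_def \<nu>_def g'_0)
  have "\<bar>m y - m' 0 * y\<bar> \<le> (C + L ^ 3) * y ^ j" if y: "0 < y" "y < min d 1" for y
  proof -
    have "y ^ j \<le> y ^ 1" "y ^ 3 \<le> y ^ j"
      using y assms(1,2) power_decreasing[of 1 j y] power_decreasing[of j 3 y] by auto
    have "\<bar>g' y\<bar> \<le> \<bar>g' y - g'' 0 * y\<bar> + \<bar>g'' 0 * y\<bar>"
      by simp
    also have "\<dots> \<le> \<bar>C\<bar> * y ^ j + \<bar>g'' 0\<bar> * y"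
      using bound[of y] y by (auto simp: abs_mult intro!: order_trans[OF bound[of y]] mult_right_mono)
    also have "\<dots> \<le> \<bar>C\<bar> * y + \<bar>g'' 0\<bar> * y"
      using \<open>y ^ j \<le> y ^ 1\<close> by (simp add: mult_left_mono)
    finally have "\<bar>g' y\<bar> \<le> L * y"
      by (simp add: L_def algebra_simps)
    have "1 \<le> sqrt (1 + (g' y)\<^sup>2)"
      by simp
    then have "\<nu> y \<le> 1"
      unfolding \<nu>_def by (intro divide_le_eq_1_pos[THEN iffD2]) linarith+
    have "1 - \<nu> y \<le> 1 - (\<nu> y)\<^sup>2"
      using \<open>\<nu> y \<le> 1\<close> \<nu>_pos[of y] by (simp add: power2_eq_square)
    also have "\<dots> = (\<nu> y)\<^sup>2 * (g' y)\<^sup>2"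
      using \<nu>_square[of y] by (simp add: algebra_simps)
    also have "\<dots> \<le> (g' y)\<^sup>2"
      using \<open>\<nu> y \<le> 1\<close> \<nu>_pos[of y] by (simp add: mult_left_le_one_le power_le_one)
    finally have "1 - \<nu> y \<le> \<bar>g' y\<bar>\<^sup>2"
      by simp
    have "\<bar>m y + g' y\<bar> = \<bar>g' y\<bar> * (1 - \<nu> y)"
    proof -
      have "m y + g' y = g' y * (1 - \<nu> y)"
        by (simp add: m_def algebra_simps)
      then show ?thesis
        using \<open>\<nu> y \<le> 1\<close> by (simp add: abs_mult)
    qed
    also have "\<dots> \<le> \<bar>g' y\<bar> * \<bar>g' y\<bar>\<^sup>2"
      using \<open>1 - \<nu> y \<le> \<bar>g' y\<bar>\<^sup>2\<close> by (intro mult_left_mono) auto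
    also have "\<dots> = \<bar>g' y\<bar> ^ 3"
      by (simp add: power2_eq_square power3_eq_cube)
    also have "\<dots> \<le> (L * y) ^ 3"
      using \<open>\<bar>g' y\<bar> \<le> L * y\<close> by (intro power_mono) auto
    also have "\<dots> \<le> L ^ 3 * y ^ j"
      using \<open>y ^ 3 \<le> y ^ j\<close> unfolding power_mult_distrib by (intro mult_left_mono) (auto simp: L_def)
    finally have "\<bar>m y + g' y\<bar> \<le> L ^ 3 * y ^ j" .
    moreover have "\<bar>g' y - g'' 0 * y\<bar> \<le> C * y ^ j"
      using bound y by simp
    ultimately have "\<bar>m y - m' 0 * y\<bar> \<le> L ^ 3 * y ^ j + C * y ^ j"
      by (simp add: m'0)
    then show ?thesis
      by (simp add: algebra_simps)
  qed
  then show thesis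
    using that by blast
qed

text \<open>By the mean value theorem, as \<open>m'\<close> stays nonzero near \<open>0\<close>.
  Injectivity recovers \<open>y\<close> from the sine of the Gauss angle.\<close>

lemma m_inj_near_0:
  assumes "isCont m' 0" "m' 0 \<noteq> 0"
  obtains d where "0 < d" "d \<le> \<delta>" "inj_on m {-d<..<d}"
proof -
  have "\<forall>\<^sub>F y in nhds 0. m' y \<noteq> 0"
    using assms tendsto_imp_eventually_ne unfolding isCont_def
    by (simp add: eventually_nhds_conv_at tendsto_imp_eventually_ne)
  then obtain e where "e > 0" and e: "\<And>y. \<bar>y\<bar> < e \<Longrightarrow> m' y \<noteq> 0"
    unfolding eventually_nhds_metric by (auto simp: dist_real_def)
  define d where "d = min e \<delta>"
  have *: "m x \<noteq> m y" if "x \<in> {-d<..<d}" "y \<in> {-d<..<d}" "x < y" for x y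
  proof
    assume "m x = m y"
    have "\<exists>z>x. z < y \<and> m y - m x = (y - x) * m' z"
      using that by (intro MVT2 has_derivative_m) (auto simp: d_def)
    then obtain z where "x < z" "z < y" "(y - x) * m' z = 0"
      using \<open>m x = m y\<close> by auto
    moreover have "\<bar>z\<bar> < e"
      using that \<open>x < z\<close> \<open>z < y\<close> by (auto simp: d_def abs_less_iff)
    ultimately show False
      using e[of z] that by auto
  qed
  have "inj_on m {-d<..<d}"
    unfolding inj_on_def using * by (metis linorder_neqE_linordered_idom)
  then show thesis
    using that[of d] \<open>e > 0\<close> \<delta> by (auto simp: d_def)
qed

text \<open>The given limit is composed with the angle \<open>arcsin (m y)\<close>. Whatever the
  parametrisation, its point at this angle must be \<open>q y\<close>, because \<open>m\<close> is
  injective near \<open>0\<close>.\<close>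

lemma umbilic_slope_limit:
  assumes "isCont m' 0" "m' 0 \<noteq> 0" "has_umbilic_slope S N a p \<mu>"
  shows "((\<lambda>y. (1 / m' y - 1 / m' 0) / (1 / (m y / y) - 1 / m' 0)) \<longlongrightarrow> \<mu>) (at_right 0)"
proof -
  obtain d where "0 < d" "d \<le> \<delta>" and inj: "inj_on m {-d<..<d}"
    using m_inj_near_0[OF assms(1,2)] .
  obtain \<epsilon> \<rho> h where param: "gauss_parametrisation S N a p \<epsilon> \<rho> h"
    and lim: "((\<lambda>\<theta>. (r2 S N (profile_point a (\<rho> \<theta>) (h \<theta>)) - r1 S N p) /
              (r1 S N (profile_point a (\<rho> \<theta>) (h \<theta>)) - r1 S N p)) \<longlongrightarrow> \<mu>) (at 0)"
    using assms(3) unfolding has_umbilic_slope_def by blast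
  define \<xi> where "\<xi> \<theta> = profile_point a (\<rho> \<theta>) (h \<theta>)" for \<theta>
  have "\<epsilon> > 0" and cont: "continuous_on {-\<epsilon><..<\<epsilon>} \<rho>" "continuous_on {-\<epsilon><..<\<epsilon>} h" and "\<xi> 0 = p"
    and \<xi>: "\<And>\<theta>. \<bar>\<theta>\<bar> < \<epsilon> \<Longrightarrow> \<xi> \<theta> \<in> S \<and> N (\<xi> \<theta>) = profile_point a (sin \<theta>) (cos \<theta>)"
    using param by (auto simp: gauss_parametrisation_def \<xi>_def abs_less_iff)
  have "isCont \<rho> 0" "isCont h 0"
    using cont \<open>\<epsilon> > 0\<close> by (auto simp: continuous_on_eq_continuous_at)
  then have "isCont \<xi> 0"
    unfolding \<xi>_def[abs_def] profile_point_def by (intro continuous_intros)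
  have "\<rho> 0 = 0"
    using \<open>\<xi> 0 = p\<close> p(2) profile_point_nth(2)[OF a, of "\<rho> 0" "h 0"] by (simp add: \<xi>_def z_axis_def)
  have "\<forall>\<^sub>F \<theta> in nhds 0. dist (\<xi> \<theta>) p < \<eta>"
    using tendstoD[OF \<open>isCont \<xi> 0\<close>[unfolded isCont_def tendsto_at_iff_tendsto_nhds] \<eta>]
    by (simp add: \<open>\<xi> 0 = p\<close>)
  moreover have "\<forall>\<^sub>F \<theta> in nhds 0. dist (\<rho> \<theta>) 0 < d"
    using tendstoD[OF \<open>isCont \<rho> 0\<close>[unfolded isCont_def tendsto_at_iff_tendsto_nhds] \<open>0 < d\<close>]
    by (simp add: \<open>\<rho> 0 = 0\<close>)
  moreover have "\<forall>\<^sub>F \<theta>::real in nhds 0. dist \<theta> 0 < \<epsilon>"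
    using \<open>\<epsilon> > 0\<close> unfolding eventually_nhds_metric by blast
  \<comment> \<open>Continuity keeps the parametrised curve in the ball where \<open>S\<close> is
    the graph; comparing the y-components of the two expressions for the normal gives the
    sine.\<close>
  ultimately have \<rho>: "\<forall>\<^sub>F \<theta> in nhds 0. \<bar>\<rho> \<theta>\<bar> < d \<and> \<xi> \<theta> = q (\<rho> \<theta>) \<and> m (\<rho> \<theta>) = sin \<theta>"
  proof eventually_elim
    case (elim \<theta>)
    then have *: "\<xi> \<theta> \<in> S \<inter> ball p \<eta>" "N (\<xi> \<theta>) = profile_point a (sin \<theta>) (cos \<theta>)"
      using \<xi>[of \<theta>] by (auto simp: dist_commute)
    then have "\<xi> \<theta> = q (\<rho> \<theta>)"
      using graph_unique[of "\<rho> \<theta>" "h \<theta>"] by (simp add: \<xi>_def q_def)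
    moreover have "N (q (\<rho> \<theta>)) = n (\<rho> \<theta>)"
      using elim \<open>d \<le> \<delta>\<close> by (intro normal_q) auto
    ultimately have "m (\<rho> \<theta>) = sin \<theta>"
      using *(2) n_nth(2)[of "\<rho> \<theta>"] profile_point_nth(2)[OF a] by metis
    then show ?case
      using elim \<open>\<xi> \<theta> = q (\<rho> \<theta>)\<close> by simp
  qed
  define \<theta> where "\<theta> y = arcsin (m y)" for y
  have m_le: "\<bar>m y\<bar> \<le> 1" for y
  proof -
    have "(m y)\<^sup>2 \<le> 1"
      using m_\<nu>[of y] zero_le_power2[of "\<nu> y"] by linarith
    then show ?thesis
      by (simp add: abs_square_le_1)
  qed
  have sin_\<theta>: "sin (\<theta> y) = m y" for y
    using m_le[of y] by (simp add: \<theta>_def abs_le_iff)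
  have "isCont m 0"
    using has_derivative_m[of 0] \<delta> DERIV_isCont by force
  then have "(m \<longlongrightarrow> 0) (at_right 0)"
    using m_0 by (simp add: isCont_def filterlim_at_split)
  then have "(\<theta> \<longlongrightarrow> 0) (at_right 0)"
    unfolding \<theta>_def[abs_def] using isCont_tendsto_compose[of 0 arcsin m] isCont_arcsin[of 0] by simp
  have small: "\<forall>\<^sub>F y in at_right 0. 0 < y \<and> y < d"
    using \<open>0 < d\<close> unfolding eventually_at_right_field by blast
  then have "\<forall>\<^sub>F y in at_right 0. \<theta> y \<noteq> 0"
  proof eventually_elim
    case (elim y)
    then have "m y \<noteq> m 0"
      using inj_onD[OF inj, of y 0] by auto
    then show ?case
      using sin_\<theta>[of y] m_0 by auto
  qed
  \<comment> \<open>The limit defining the slope is punctured at angle \<open>0\<close>, so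
    convergence of \<open>\<theta> y\<close> to \<open>0\<close> must come with
    \<open>\<theta> y \<noteq> 0\<close>.\<close>
  then have "filterlim \<theta> (at 0) (at_right 0)"
    using \<open>(\<theta> \<longlongrightarrow> 0) (at_right 0)\<close> by (simp add: filterlim_at)
  from filterlim_compose[OF lim this]
  have "((\<lambda>y. (r2 S N (\<xi> (\<theta> y)) - r1 S N p) / (r1 S N (\<xi> (\<theta> y)) - r1 S N p)) \<longlongrightarrow> \<mu>) (at_right 0)"
    by (simp add: \<xi>_def)
  moreover have "\<forall>\<^sub>F y in at_right 0. (r2 S N (\<xi> (\<theta> y)) - r1 S N p) / (r1 S N (\<xi> (\<theta> y)) - r1 S N p)
      = (1 / m' y - 1 / m' 0) / (1 / (m y / y) - 1 / m' 0)"
    using small eventually_compose_filterlim[OF \<rho> \<open>(\<theta> \<longlongrightarrow> 0) (at_right 0)\<close>]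
  proof eventually_elim
    case (elim y)
    then have "\<rho> (\<theta> y) \<in> {-d<..<d}" "y \<in> {-d<..<d}" "m (\<rho> (\<theta> y)) = m y"
      by (auto simp: sin_\<theta> abs_less_iff)
    then have "\<rho> (\<theta> y) = y"
      using inj_onD[OF inj] by blast
    moreover have "\<bar>y\<bar> < \<delta>" "y \<noteq> 0"
      using elim \<open>d \<le> \<delta>\<close> by auto
    ultimately show ?case
      using elim by (simp add: r1_def r2_def k1_p k1_q k2_q)
  qed
  ultimately show ?thesis
    by (simp add: tendsto_cong)
qed

end

subsection \<open>The lower bounds for the umbilic slope\<close>

lemma normal_eq_axis:
  assumes "unit_normal_field S N" "p \<in> S" "axis_orientation a" "gauss_angle a N p = 0"
  shows "N p = a"
proof -
  have "norm (N p) = 1"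
    using assms(1,2) by (simp add: unit_normal_field_def)
  then have N: "N p \<bullet> N p = 1"
    by (simp add: norm_eq_1)
  have aa: "a \<bullet> a = 1"
    using axis_orientation_nth(3)[OF assms(3)] inner_axis_orientation[OF assms(3), of a] by simp
  then have "norm a = 1"
    by (simp add: norm_eq_1)
  have "\<bar>N p \<bullet> a\<bar> \<le> 1"
    using Cauchy_Schwarz_ineq2[of "N p" a] \<open>norm (N p) = 1\<close> \<open>norm a = 1\<close> by simp
  then have "N p \<bullet> a = cos 0"
    using assms(4) cos_arccos_abs[of "N p \<bullet> a"] by (simp add: gauss_angle_def)
  then have "(N p - a) \<bullet> (N p - a) = 0"
    using N aa by (simp add: inner_diff inner_commute)
  then show ?thesis
    by simp
qed

text \<open>Both smoothness classes at once: differentiating the profile costs one order, leaving an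
  expansion of \<open>m\<close> with remainder of order \<open>k - 1\<close>.\<close>

lemma umbilic_slope_ge:
  assumes surf: "surface_of_revolution k S N" and k: "k = 3 \<or> k = 4"
    and convex: "strictly_convex S N" and umbilic: "isolated_umbilic S N p" and axis: "p \<in> z_axis"
    and a: "axis_orientation a" and angle: "gauss_angle a N p = 0"
    and slope: "has_umbilic_slope S N a p \<mu>"
  shows "real (k - 1) \<le> \<mu>"
proof -
  have regular: "regular_surface k S" and normal: "unit_normal_field S N"
    and rot: "rot_z \<alpha> ` S = S" for \<alpha>
    using surf by (auto simp: surface_of_revolution_def)
  have "p \<in> S"
    using umbilic by (simp add: isolated_umbilic_def umbilic_def)
  have "N p = a"
    by (rule normal_eq_axis[OF normal \<open>p \<in> S\<close> a angle])
  have tangent: "a \<bullet> v = 0" if "v \<in> tangent_space S p" for v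
    using normal that \<open>p \<in> S\<close> \<open>N p = a\<close> by (auto simp: unit_normal_field_def)
  have "0 < k"
    using k by auto
  obtain \<delta>0 D where "0 < \<delta>0" and graph: "\<And>y. \<bar>y\<bar> < \<delta>0 \<Longrightarrow> profile_point a y (D 0 y) \<in> S"
    and unique: "\<And>y z. profile_point a y z \<in> S \<inter> ball p \<delta>0 \<Longrightarrow> z = D 0 y"
    and D: "\<And>j y. j < k \<Longrightarrow> \<bar>y\<bar> < \<delta>0 \<Longrightarrow> (D j has_real_derivative D (Suc j) y) (at y)"
    and contD: "continuous_on {-\<delta>0<..<\<delta>0} (D k)"
    using profile_graph[OF regular \<open>0 < k\<close> \<open>p \<in> S\<close> axis a tangent] by blast
  have "continuous_on S (\<lambda>x. N x \<bullet> a)"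
    using normal by (intro continuous_intros) (simp add: unit_normal_field_def)
  then obtain e where "e > 0" and e: "\<And>x. x \<in> S \<Longrightarrow> dist x p < e \<Longrightarrow> dist (N x \<bullet> a) (N p \<bullet> a) < 1"
    using \<open>p \<in> S\<close> unfolding continuous_on_iff by (metis zero_less_one)
  have "N p \<bullet> a = 1"
    using \<open>N p = a\<close> axis_orientation_nth(3)[OF a] inner_axis_orientation[OF a, of a] by simp
  \<comment> \<open>\<open>\<delta>0\<close> secures uniqueness of the graph, \<open>e\<close> the
    sign of the normal; \<open>\<delta>1\<close> below keeps the graph inside this ball.\<close>
  define \<eta> where "\<eta> = min \<delta>0 e"
  have "\<eta> > 0"
    using \<open>0 < \<delta>0\<close> \<open>e > 0\<close> by (simp add: \<eta>_def)
  have "p = profile_point a 0 (p \<bullet> a)"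
    using eq_profile_pointI[OF a] axis by (simp add: z_axis_def)
  then have p_eq: "profile_point a 0 (D 0 0) = p"
    using unique[of 0 "p \<bullet> a"] \<open>p \<in> S\<close> \<open>0 < \<delta>0\<close> by simp
  have "isCont (D 0) 0"
    using D[of 0 0] k \<open>0 < \<delta>0\<close> DERIV_isCont by force
  then have "isCont (\<lambda>y. profile_point a y (D 0 y)) 0"
    unfolding profile_point_def by (intro continuous_intros)
  then obtain \<delta>1 where "\<delta>1 > 0" and \<delta>1: "\<And>y. \<bar>y\<bar> < \<delta>1 \<Longrightarrow> dist (profile_point a y (D 0 y)) p < \<eta>"
    using \<open>\<eta> > 0\<close> unfolding continuous_at_eps_delta p_eq by (auto simp: dist_real_def)
  define \<delta> where "\<delta> = min \<delta>0 \<delta>1"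
  have "\<delta> > 0" "\<delta> \<le> \<delta>0"
    using \<open>\<delta>1 > 0\<close> \<open>0 < \<delta>0\<close> by (simp_all add: \<delta>_def)
  interpret axial_profile S N a p \<delta> \<eta> "D 0" "D 1" "D 2"
  proof
    show "profile_point a y (D 0 y) \<in> S \<inter> ball p \<eta>" if "\<bar>y\<bar> < \<delta>" for y
      using graph[of y] \<delta>1[of y] that by (simp add: \<delta>_def dist_commute)
    show "z = D 0 y" if "profile_point a y z \<in> S \<inter> ball p \<eta>" for y z
      using unique[of y z] that by (simp add: \<eta>_def)
    show "(D 0 has_real_derivative D 1 y) (at y)" "(D 1 has_real_derivative D 2 y) (at y)" if "\<bar>y\<bar> < \<delta>" for y
      using D[of 0 y] D[of 1 y] that k by (auto simp: \<delta>_def numeral_2_eq_2)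
    show "N x \<bullet> a > 0" if "x \<in> S \<inter> ball p \<eta>" for x
      using e[of x] that \<open>N p \<bullet> a = 1\<close> by (auto simp: \<eta>_def dist_commute dist_real_def)
  qed (use rot normal a axis \<open>p \<in> S\<close> \<open>N p = a\<close> \<open>\<delta> > 0\<close> \<open>\<eta> > 0\<close> in auto)
  have D\<delta>: "(D j has_real_derivative D (Suc j) y) (at y)" if "j < k" "\<bar>y\<bar> < \<delta>" for j y
    using D that \<open>\<delta> \<le> \<delta>0\<close> by simp
  have odd_0: "D (Suc j) 0 = 0" if "even j" "Suc j \<le> k" for j
  proof -
    have "D (Suc j) (- 0) = (- 1) ^ Suc j * D (Suc j) 0"
      by (rule iterated_derivatives_parity[OF D\<delta> g_even that(2)]) (use \<open>\<delta> > 0\<close> in simp_all)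
    then show ?thesis
      using that(1) by simp
  qed
  \<comment> \<open>The coefficients of \<open>D 1\<close> to be killed have index 0 and, for
    \<open>k = 4\<close>, also 2. They are the odd derivatives \<open>D 1 0\<close> and
    \<open>D 3 0\<close> of the even profile.\<close>
  have even_less: "even j" if "j < k - 1" "j \<noteq> 1" for j
  proof -
    have "j = 0 \<or> j = 2"
      using that k by auto
    then show ?thesis
      by auto
  qed
  obtain C where C: "\<And>y. 0 < y \<Longrightarrow> y < \<delta> / 2 \<Longrightarrow> \<bar>D 1 y - D 2 0 * y\<bar> \<le> C * y ^ (k - 1)"
  proof (rule Maclaurin_linear_bound[of \<delta> "k - 1" "\<lambda>j. D (Suc j)"])
    show "2 \<le> k - 1"
      using k by auto
    show "(D (Suc j) has_real_derivative D (Suc (Suc j)) y) (at y)" if "j < k - 1" "\<bar>y\<bar> < \<delta>" for j y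
      using D\<delta>[of "Suc j" y] that by simp
    show "continuous_on {-\<delta><..<\<delta>} (D (Suc (k - 1)))"
    proof -
      have "{-\<delta><..<\<delta>} \<subseteq> {-\<delta>0<..<\<delta>0}"
        using \<open>\<delta> \<le> \<delta>0\<close> by auto
      then show ?thesis
        using continuous_on_subset[OF contD] \<open>0 < k\<close> by simp
    qed
    show "D (Suc j) 0 = 0" if "j < k - 1" "j \<noteq> 1" for j
      using odd_0[OF even_less[OF that]] that by simp
  qed (use \<open>\<delta> > 0\<close> in \<open>auto simp: numeral_2_eq_2\<close>)
  have k_range: "2 \<le> k - 1" "k - 1 \<le> 3"
    using k by auto
  obtain K where K: "\<And>y. 0 < y \<Longrightarrow> y < min (\<delta> / 2) 1 \<Longrightarrow> \<bar>m y - m' 0 * y\<bar> \<le> K * y ^ (k - 1)"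
    using m_linear_bound[OF k_range C] by blast
  have "isCont (D 2) 0"
    using D\<delta>[of 2 0] k \<open>\<delta> > 0\<close> DERIV_isCont by force
  note cont = isCont_m'[OF this]
  have "gauss_curvature S N p > 0"
    using convex \<open>p \<in> S\<close> by (simp add: strictly_convex_def)
  then have "m' 0 \<noteq> 0"
    by (auto simp: gauss_curvature_def k1_p)
  obtain V where "open V" "p \<in> V" and V: "\<And>x. x \<in> S \<inter> V - {p} \<Longrightarrow> \<not> umbilic S N x"
    using umbilic unfolding isolated_umbilic_def by blast
  have "\<forall>\<^sub>F y in nhds 0. q y \<in> V"
    using topological_tendstoD[OF isCont_q[unfolded isCont_def tendsto_at_iff_tendsto_nhds] \<open>open V\<close>] \<open>p \<in> V\<close>
    by (simp add: q_0)
  then obtain d where "d > 0" and d: "\<And>y. \<bar>y\<bar> < d \<Longrightarrow> q y \<in> V"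
    unfolding eventually_nhds_metric by (auto simp: dist_real_def)
  show ?thesis
  \<comment> \<open>The radius combines the halving for the Maclaurin bound, the comparison of
    powers of \<open>y\<close> below 1, and the neighbourhood of \<open>p\<close> free of other
    umbilics.\<close>
  proof (rule umbilic_slope_bound[of "min (min (\<delta> / 2) 1) d" "k - 1" m m' K])
    show "m' y \<noteq> m y / y" if y: "0 < y" "y < min (min (\<delta> / 2) 1) d" for y
    proof -
      have "\<bar>y\<bar> < \<delta>" "y \<noteq> 0"
        using y by auto
      moreover have "q y \<noteq> p"
        using q_nth(2)[of y] axis y by (auto simp: z_axis_def)
      then have "\<not> umbilic S N (q y)"
        using V[of "q y"] d[of y] y q_mem(1)[OF \<open>\<bar>y\<bar> < \<delta>\<close>] by auto
      ultimately show ?thesis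
        using q_mem(1)[of y] by (auto simp: umbilic_def r1_def r2_def k1_q k2_q)
    qed
    show "((\<lambda>y. (1 / m' y - 1 / m' 0) / (1 / (m y / y) - 1 / m' 0)) \<longlongrightarrow> \<mu>) (at_right 0)"
      by (rule umbilic_slope_limit[OF cont \<open>m' 0 \<noteq> 0\<close> slope])
  qed (use \<open>\<delta> > 0\<close> \<open>d > 0\<close> k cont m_0 \<open>m' 0 \<noteq> 0\<close> K has_derivative_m in auto)
qed

theorem corollary3p10:
  fixes S :: "(real^3) set" and N :: "real^3 \<Rightarrow> real^3" and a p :: "real^3"
  assumes "surface_of_revolution 3 S N"
    and "strictly_convex S N"
    and "isolated_umbilic S N p"
    and "p \<in> z_axis"
    and "axis_orientation a"
    and "gauss_angle a N p = 0"
  shows "(\<forall>\<mu>. has_umbilic_slope S N a p \<mu> \<longrightarrow> \<mu> \<ge> 2) \<and>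
    (surface_of_revolution 4 S N \<longrightarrow> (\<forall>\<mu>. has_umbilic_slope S N a p \<mu> \<longrightarrow> \<mu> \<ge> 3))"
  using umbilic_slope_ge[of 3 S N p a] umbilic_slope_ge[of 4 S N p a] assms(1-6) by auto

end
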